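(* Let $k$ be a field. For $k$-algebras $A$ and $B$, let $R=A\oplus B$ be their direct sum (product algebra). Then $R$ is homologically smooth over $k$ if and only if both $A$ and $B$ are homologically smooth over $k$.
   Context: Algebras are unital and associative over the arbitrary field $k$. With $A^e=A\otimes_kA^{\mathrm{op}}$, a $k$-algebra $A$ is homologically smooth over $k$ if $A$ is perfect as a left $A^e$-module, i.e. has a finite-length resolution by finitely generated projective left $A^e$-modules. *)

theory Defs
  imports "HOL-Algebra.Algebra" "HOL-Library.Poly_Mapping"
begin

section \<open>Unital associative algebras\<close>

text \<open>
  The library locale \<open>algebra\<close> requires the algebra itself to be commutative.  Here only the base
  is commutative.  The zero algebra is allowed.
\<close>

locale assoc_algebra = module R A + A?: ring A
  for R :: "('r, 'x) ring_scheme" (structure) and A :: "('r, 'a, 'y) module_scheme" (structure) +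
  assumes smult_mult_left:
      "\<lbrakk>r \<in> carrier R; x \<in> carrier A; y \<in> carrier A\<rbrakk>
        \<Longrightarrow> (r \<odot>\<^bsub>A\<^esub> x) \<otimes>\<^bsub>A\<^esub> y = r \<odot>\<^bsub>A\<^esub> (x \<otimes>\<^bsub>A\<^esub> y)"
    and smult_mult_right:
      "\<lbrakk>r \<in> carrier R; x \<in> carrier A; y \<in> carrier A\<rbrakk>
        \<Longrightarrow> x \<otimes>\<^bsub>A\<^esub> (r \<odot>\<^bsub>A\<^esub> y) = r \<odot>\<^bsub>A\<^esub> (x \<otimes>\<^bsub>A\<^esub> y)"

definition direct_sum_algebra ::
    "('r, 'a, 'y) module_scheme \<Rightarrow> ('r, 'b, 'z) module_scheme \<Rightarrow> ('r, 'a \<times> 'b) module"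
  where "direct_sum_algebra A B =
    ring.extend (RDirProd A B) (module.fields (\<lambda>r (a, b). (r \<odot>\<^bsub>A\<^esub> a, r \<odot>\<^bsub>B\<^esub> b)))"

definition opposite_algebra :: "('r, 'a, 'y) module_scheme \<Rightarrow> ('r, 'a, 'y) module_scheme"
  where "opposite_algebra A = A\<lparr>mult := (\<lambda>x y. y \<otimes>\<^bsub>A\<^esub> x)\<rparr>"

section \<open>Tensor products and the enveloping algebra\<close>

text \<open>
  The tensor product over \<open>R\<close> is the quotient of the free abelian group on the pairs \<open>(a, b)\<close> by the
  subgroup generated by the additivity and balancing relations.  The free group carries the ring
  structure with \<open>(a, b) (a', b') = (a a', b b')\<close>, and the relation subgroup is a two-sided ideal
  (lemma \<open>ideal_tensor_relations\<close> below), so the quotient is a ring.  Only the ring structure of the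
  tensor product is needed for modules over it.
\<close>

definition pair_ring ::
    "('a, 'y) ring_scheme \<Rightarrow> ('b, 'z) ring_scheme \<Rightarrow> ('a \<times> 'b \<Rightarrow>\<^sub>0 int) ring"
  where "pair_ring A B =
    \<lparr>carrier = {f. Poly_Mapping.keys f \<subseteq> carrier A \<times> carrier B},
     monoid.mult = (\<lambda>f g. frag_extend (\<lambda>(a, b).
        frag_extend (\<lambda>(a', b'). frag_of (a \<otimes>\<^bsub>A\<^esub> a', b \<otimes>\<^bsub>B\<^esub> b')) g) f),
     one = frag_of (\<one>\<^bsub>A\<^esub>, \<one>\<^bsub>B\<^esub>),
     ring.zero = 0,
     ring.add = (+)\<rparr>"

definition tensor_generators ::
    "('r, 'x) ring_scheme \<Rightarrow> ('r, 'a, 'y) module_scheme \<Rightarrow> ('r, 'b, 'z) module_scheme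
      \<Rightarrow> ('a \<times> 'b \<Rightarrow>\<^sub>0 int) set"
  where "tensor_generators R A B =
    {frag_of (a \<oplus>\<^bsub>A\<^esub> a', b) - frag_of (a, b) - frag_of (a', b) | a a' b.
       a \<in> carrier A \<and> a' \<in> carrier A \<and> b \<in> carrier B} \<union>
    {frag_of (a, b \<oplus>\<^bsub>B\<^esub> b') - frag_of (a, b) - frag_of (a, b') | a b b'.
       a \<in> carrier A \<and> b \<in> carrier B \<and> b' \<in> carrier B} \<union>
    {frag_of (r \<odot>\<^bsub>A\<^esub> a, b) - frag_of (a, r \<odot>\<^bsub>B\<^esub> b) | r a b.
       r \<in> carrier R \<and> a \<in> carrier A \<and> b \<in> carrier B}"

definition tensor_relations ::
    "('r, 'x) ring_scheme \<Rightarrow> ('r, 'a, 'y) module_scheme \<Rightarrow> ('r, 'b, 'z) module_scheme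
      \<Rightarrow> ('a \<times> 'b \<Rightarrow>\<^sub>0 int) set"
  where "tensor_relations R A B = generate (add_monoid (pair_ring A B)) (tensor_generators R A B)"

definition tensor_ring ::
    "('r, 'x) ring_scheme \<Rightarrow> ('r, 'a, 'y) module_scheme \<Rightarrow> ('r, 'b, 'z) module_scheme
      \<Rightarrow> ('a \<times> 'b \<Rightarrow>\<^sub>0 int) set ring"
  where "tensor_ring R A B = pair_ring A B Quot tensor_relations R A B"

definition pure_tensor ::
    "('r, 'x) ring_scheme \<Rightarrow> ('r, 'a, 'y) module_scheme \<Rightarrow> ('r, 'b, 'z) module_scheme
      \<Rightarrow> 'a \<Rightarrow> 'b \<Rightarrow> ('a \<times> 'b \<Rightarrow>\<^sub>0 int) set"
  where "pure_tensor R A B a b = tensor_relations R A B +>\<^bsub>pair_ring A B\<^esub> frag_of (a, b)"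

definition enveloping_algebra ::
    "('r, 'x) ring_scheme \<Rightarrow> ('r, 'a, 'y) module_scheme \<Rightarrow> ('a \<times> 'a \<Rightarrow>\<^sub>0 int) set ring"
  where "enveloping_algebra R A = tensor_ring R A (opposite_algebra A)"

text \<open>
  \<open>A\<close> as a left module over its enveloping algebra: \<open>a \<otimes> b\<close> sends \<open>x\<close> to \<open>a x b\<close>.  The action of a
  coset is the common value of the actions of its representatives (lemmas
  \<open>left_module_regular_bimodule\<close> and \<open>smult_regular_bimodule_pure\<close> below).
\<close>

definition pair_action :: "('a, 'y) ring_scheme \<Rightarrow> ('a \<times> 'a \<Rightarrow>\<^sub>0 int) \<Rightarrow> 'a \<Rightarrow> 'a"
  where "pair_action A f x =
    (\<Oplus>\<^bsub>A\<^esub>p\<in>Poly_Mapping.keys f.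
       add_pow A (Poly_Mapping.lookup f p) (fst p \<otimes>\<^bsub>A\<^esub> x \<otimes>\<^bsub>A\<^esub> snd p))"

definition regular_bimodule ::
    "('r, 'a, 'y) module_scheme \<Rightarrow> (('a \<times> 'a \<Rightarrow>\<^sub>0 int) set, 'a) module"
  where "regular_bimodule A =
    \<lparr>carrier = carrier A, monoid.mult = monoid.mult A, one = \<one>\<^bsub>A\<^esub>,
     ring.zero = \<zero>\<^bsub>A\<^esub>, ring.add = add A,
     smult = (\<lambda>t x. the_elem ((\<lambda>f. pair_action A f x) ` t))\<rparr>"

section \<open>Left modules over a noncommutative ring\<close>

text \<open>
  As in the library locale \<open>module\<close>, the fields \<open>mult\<close> and \<open>one\<close> of the module record play no role.
\<close>

locale left_module = R?: ring R + M?: abelian_group M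
  for R :: "('r, 'x) ring_scheme" (structure) and M :: "('r, 'm, 'y) module_scheme" (structure) +
  assumes smult_closed [simp, intro]:
      "\<lbrakk>a \<in> carrier R; x \<in> carrier M\<rbrakk> \<Longrightarrow> a \<odot>\<^bsub>M\<^esub> x \<in> carrier M"
    and smult_l_distr:
      "\<lbrakk>a \<in> carrier R; b \<in> carrier R; x \<in> carrier M\<rbrakk>
        \<Longrightarrow> (a \<oplus> b) \<odot>\<^bsub>M\<^esub> x = a \<odot>\<^bsub>M\<^esub> x \<oplus>\<^bsub>M\<^esub> b \<odot>\<^bsub>M\<^esub> x"
    and smult_r_distr:
      "\<lbrakk>a \<in> carrier R; x \<in> carrier M; y \<in> carrier M\<rbrakk>
        \<Longrightarrow> a \<odot>\<^bsub>M\<^esub> (x \<oplus>\<^bsub>M\<^esub> y) = a \<odot>\<^bsub>M\<^esub> x \<oplus>\<^bsub>M\<^esub> a \<odot>\<^bsub>M\<^esub> y"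
    and smult_assoc1:
      "\<lbrakk>a \<in> carrier R; b \<in> carrier R; x \<in> carrier M\<rbrakk>
        \<Longrightarrow> (a \<otimes> b) \<odot>\<^bsub>M\<^esub> x = a \<odot>\<^bsub>M\<^esub> (b \<odot>\<^bsub>M\<^esub> x)"
    and smult_one [simp]: "x \<in> carrier M \<Longrightarrow> \<one> \<odot>\<^bsub>M\<^esub> x = x"

definition left_module_hom ::
    "('r, 'x) ring_scheme \<Rightarrow> ('r, 'm, 'y) module_scheme \<Rightarrow> ('r, 'n, 'z) module_scheme
      \<Rightarrow> ('m \<Rightarrow> 'n) set"
  where "left_module_hom R M N =
    {h \<in> carrier M \<rightarrow> carrier N.
       (\<forall>x\<in>carrier M. \<forall>y\<in>carrier M. h (x \<oplus>\<^bsub>M\<^esub> y) = h x \<oplus>\<^bsub>N\<^esub> h y) \<and>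
       (\<forall>r\<in>carrier R. \<forall>x\<in>carrier M. h (r \<odot>\<^bsub>M\<^esub> x) = r \<odot>\<^bsub>N\<^esub> h x)}"

definition free_left_module :: "('r, 'x) ring_scheme \<Rightarrow> 'i set \<Rightarrow> ('r, 'i \<Rightarrow> 'r) module"
  where "free_left_module R I =
    \<lparr>carrier = {f. (\<forall>i\<in>I. f i \<in> carrier R) \<and> (\<forall>i. i \<notin> I \<longrightarrow> f i = \<zero>\<^bsub>R\<^esub>) \<and>
                   finite {i. f i \<noteq> \<zero>\<^bsub>R\<^esub>}},
     monoid.mult = undefined, one = undefined,
     ring.zero = (\<lambda>_. \<zero>\<^bsub>R\<^esub>),
     ring.add = (\<lambda>f g i. f i \<oplus>\<^bsub>R\<^esub> g i),
     smult = (\<lambda>r f i. r \<otimes>\<^bsub>R\<^esub> f i)\<rparr>"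

definition finitely_generated_module ::
    "('r, 'x) ring_scheme \<Rightarrow> ('r, 'm, 'y) module_scheme \<Rightarrow> bool"
  where "finitely_generated_module R M \<longleftrightarrow>
    (\<exists>S. finite S \<and> S \<subseteq> carrier M \<and>
      carrier M = {\<Oplus>\<^bsub>M\<^esub>s\<in>S. c s \<odot>\<^bsub>M\<^esub> s | c. c \<in> S \<rightarrow> carrier R})"

text \<open>
  A projective module is a direct summand of a free module.  Taking the basis inside the element
  type of \<open>M\<close> is no restriction: a projective module \<open>M\<close> is a direct summand of the free module on
  the set \<open>carrier M\<close>.
\<close>

definition projective_module ::
    "('r, 'x) ring_scheme \<Rightarrow> ('r, 'm, 'y) module_scheme \<Rightarrow> bool"
  where "projective_module R M \<longleftrightarrow>
    left_module R M \<and>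
    (\<exists>(I :: 'm set) s p.
       s \<in> left_module_hom R M (free_left_module R I) \<and>
       p \<in> left_module_hom R (free_left_module R I) M \<and>
       (\<forall>x\<in>carrier M. p (s x) = x))"

text \<open>
  The resolution is \<open>\<dots> \<rightarrow> P 1 \<rightarrow> P 0 \<rightarrow> M \<rightarrow> 0\<close> with differentials \<open>d i : P (i + 1) \<rightarrow> P i\<close>,
  augmentation \<open>e\<close>, and \<open>P i = 0\<close> for all large \<open>i\<close>.  HOL has no quantification over types, so the
  modules \<open>P i\<close> need a fixed element type.  The type \<open>nat \<Rightarrow> 'r\<close> loses nothing, since every finitely
  generated projective module over \<open>R\<close> is isomorphic to a submodule of some \<open>R\<^sup>n\<close>, that is, of the
  free module on \<open>{..<n}\<close>.
\<close>

definition perfect_module ::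
    "('r, 'x) ring_scheme \<Rightarrow> ('r, 'm, 'y) module_scheme \<Rightarrow> bool"
  where "perfect_module R M \<longleftrightarrow>
    (\<exists>(P :: nat \<Rightarrow> ('r, nat \<Rightarrow> 'r) module) d e n.
       (\<forall>i. projective_module R (P i) \<and> finitely_generated_module R (P i)) \<and>
       (\<forall>i. d i \<in> left_module_hom R (P (Suc i)) (P i)) \<and>
       e \<in> left_module_hom R (P 0) M \<and>
       e ` carrier (P 0) = carrier M \<and>
       d 0 ` carrier (P 1) = a_kernel (P 0) M e \<and>
       (\<forall>i. d (Suc i) ` carrier (P (Suc (Suc i))) = a_kernel (P (Suc i)) (P i) (d i)) \<and>
       (\<forall>i>n. carrier (P i) = {\<zero>\<^bsub>P i\<^esub>}))"

definition homologically_smooth ::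
    "('r, 'x) ring_scheme \<Rightarrow> ('r, 'a, 'y) module_scheme \<Rightarrow> bool"
  where "homologically_smooth R A \<longleftrightarrow>
    perfect_module (enveloping_algebra R A) (regular_bimodule A)"

section \<open>The definitions are well formed\<close>

lemma assoc_algebra_direct_sum:
  assumes "assoc_algebra R A" "assoc_algebra R B"
  shows "assoc_algebra R (direct_sum_algebra A B)"
proof -
  interpret A: assoc_algebra R A by fact
  interpret B: assoc_algebra R B by fact
  interpret P: ring "RDirProd A B"
    by (rule RDirProd_ring) (rule A.ring_axioms, rule B.ring_axioms)
  let ?D = "direct_sum_algebra A B"
  have D: "carrier ?D = carrier A \<times> carrier B"
    "add ?D = (\<lambda>(a, b) (a', b'). (a \<oplus>\<^bsub>A\<^esub> a', b \<oplus>\<^bsub>B\<^esub> b'))"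
    "monoid.mult ?D = (\<lambda>(a, b) (a', b'). (a \<otimes>\<^bsub>A\<^esub> a', b \<otimes>\<^bsub>B\<^esub> b'))"
    "\<one>\<^bsub>?D\<^esub> = (\<one>\<^bsub>A\<^esub>, \<one>\<^bsub>B\<^esub>)" "\<zero>\<^bsub>?D\<^esub> = (\<zero>\<^bsub>A\<^esub>, \<zero>\<^bsub>B\<^esub>)"
    "smult ?D = (\<lambda>r (a, b). (r \<odot>\<^bsub>A\<^esub> a, r \<odot>\<^bsub>B\<^esub> b))"
    by (simp_all add: direct_sum_algebra_def ring.defs module.defs RDirProd_def DirProd_def monoid.defs)
  have rD: "ring ?D"
  proof (intro ringI abelian_groupI monoidI, goal_cases)
    case (6 x)
    then show ?case
      by (auto simp: D intro!: bexI[of _ "(\<ominus>\<^bsub>A\<^esub> fst x, \<ominus>\<^bsub>B\<^esub> snd x)"] A.l_neg B.l_neg)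
  qed (auto simp: D A.ring_simprules B.ring_simprules)
  show ?thesis
  proof (intro assoc_algebra.intro module.intro assoc_algebra_axioms.intro module_axioms.intro rD A.is_cring ring.is_abelian_group[OF rD])
  qed (auto simp: D A.smult_l_distr B.smult_l_distr A.smult_r_distr B.smult_r_distr
      A.smult_assoc1 B.smult_assoc1 A.smult_mult_left B.smult_mult_left A.smult_mult_right B.smult_mult_right)
qed

lemma assoc_algebra_opposite:
  assumes "assoc_algebra R A"
  shows "assoc_algebra R (opposite_algebra A)"
proof -
  interpret A: assoc_algebra R A by fact
  let ?D = "opposite_algebra A"
  have D: "carrier ?D = carrier A" "add ?D = add A" "\<one>\<^bsub>?D\<^esub> = \<one>\<^bsub>A\<^esub>" "\<zero>\<^bsub>?D\<^esub> = \<zero>\<^bsub>A\<^esub>"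
    "monoid.mult ?D = (\<lambda>x y. y \<otimes>\<^bsub>A\<^esub> x)" "smult ?D = smult A"
    by (simp_all add: opposite_algebra_def)
  have rD: "ring ?D"
  proof (intro ringI abelian_groupI monoidI, goal_cases)
    case (6 x)
    then show ?case
      by (auto simp: D intro!: bexI[of _ "\<ominus>\<^bsub>A\<^esub> x"] A.l_neg)
  qed (auto simp: D A.ring_simprules)
  show ?thesis
  proof (intro assoc_algebra.intro module.intro assoc_algebra_axioms.intro module_axioms.intro rD A.is_cring ring.is_abelian_group[OF rD])
  qed (auto simp: D A.smult_l_distr A.smult_r_distr A.smult_assoc1 A.smult_mult_left A.smult_mult_right)
qed

lemma frag_extend_fun_add:
  "frag_extend (\<lambda>p. h p + k p) x = frag_extend h x + frag_extend k x"
  by (simp add: frag_extend_def frag_cmul_distrib2 sum.distrib)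

lemma frag_cmul_diff_right: "frag_cmul c (u - v) = frag_cmul c u - frag_cmul c v"
  by (rule poly_mapping_eqI) (simp add: lookup_minus algebra_simps)

lemma frag_extend_fun_diff:
  "frag_extend (\<lambda>p. h p - k p) x = frag_extend h x - frag_extend k x"
  by (simp add: frag_extend_def frag_cmul_diff_right sum_subtractf)

context
  fixes A :: "('a, 'y) ring_scheme" and B :: "('b, 'z) ring_scheme"
begin

lemma pair_ring_simps [simp]:
  "f \<in> carrier (pair_ring A B) \<longleftrightarrow> Poly_Mapping.keys f \<subseteq> carrier A \<times> carrier B"
  "\<one>\<^bsub>pair_ring A B\<^esub> = frag_of (\<one>\<^bsub>A\<^esub>, \<one>\<^bsub>B\<^esub>)" "\<zero>\<^bsub>pair_ring A B\<^esub> = 0"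
  "f \<oplus>\<^bsub>pair_ring A B\<^esub> g = f + g"
  by (simp_all add: pair_ring_def)

lemma pair_mult_of [simp]:
  "frag_of (a, b) \<otimes>\<^bsub>pair_ring A B\<^esub> frag_of (a', b') = frag_of (a \<otimes>\<^bsub>A\<^esub> a', b \<otimes>\<^bsub>B\<^esub> b')"
  by (simp add: pair_ring_def)

lemma pair_mult_zero [simp]:
  "0 \<otimes>\<^bsub>pair_ring A B\<^esub> g = 0" "f \<otimes>\<^bsub>pair_ring A B\<^esub> 0 = 0"
  by (simp_all add: pair_ring_def case_prod_unfold) (simp add: frag_extend_def)

lemma pair_mult_diff:
  "(f - f') \<otimes>\<^bsub>pair_ring A B\<^esub> g = f \<otimes>\<^bsub>pair_ring A B\<^esub> g - f' \<otimes>\<^bsub>pair_ring A B\<^esub> g"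
  "f \<otimes>\<^bsub>pair_ring A B\<^esub> (g - g') = f \<otimes>\<^bsub>pair_ring A B\<^esub> g - f \<otimes>\<^bsub>pair_ring A B\<^esub> g'"
  by (simp_all add: pair_ring_def case_prod_unfold frag_extend_diff frag_extend_fun_diff)

lemma pair_mult_add:
  "(f + f') \<otimes>\<^bsub>pair_ring A B\<^esub> g = f \<otimes>\<^bsub>pair_ring A B\<^esub> g + f' \<otimes>\<^bsub>pair_ring A B\<^esub> g"
  "f \<otimes>\<^bsub>pair_ring A B\<^esub> (g + g') = f \<otimes>\<^bsub>pair_ring A B\<^esub> g + f \<otimes>\<^bsub>pair_ring A B\<^esub> g'"
  by (simp_all add: pair_ring_def case_prod_unfold frag_extend_add frag_extend_fun_add)

lemma pair_ring_induct [consumes 1, case_names zero diff of]: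
  assumes "Poly_Mapping.keys f \<subseteq> carrier A \<times> carrier B" and "P 0"
    and "\<And>f g. \<lbrakk>Poly_Mapping.keys f \<subseteq> carrier A \<times> carrier B; Poly_Mapping.keys g \<subseteq> carrier A \<times> carrier B;
       P f; P g\<rbrakk> \<Longrightarrow> P (f - g)"
    and "\<And>a b. \<lbrakk>a \<in> carrier A; b \<in> carrier B\<rbrakk> \<Longrightarrow> P (frag_of (a, b))"
  shows "P f"
  using assms(1) by (rule free_Abelian_group_induct) (use assms in auto)

lemma ring_pair_ring:
  assumes "ring A" "ring B" shows "ring (pair_ring A B)"
proof -
  interpret A: ring A by fact
  interpret B: ring B by fact
  let ?F = "pair_ring A B" and ?K = "carrier A \<times> carrier B"
  have df: "Poly_Mapping.keys (f - g) \<subseteq> ?K" if "Poly_Mapping.keys f \<subseteq> ?K" "Poly_Mapping.keys g \<subseteq> ?K" for f g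
    using that keys_diff[of f g] by blast
  have cl: "Poly_Mapping.keys (f \<otimes>\<^bsub>?F\<^esub> g) \<subseteq> ?K"
    if "Poly_Mapping.keys f \<subseteq> ?K" "Poly_Mapping.keys g \<subseteq> ?K" for f g
    using that
  proof (induction f rule: pair_ring_induct)
    case (diff f f') then show ?case unfolding pair_mult_diff by (intro df)
  next
    case (of a b)
    from of(3) show ?case
    proof (induction g rule: pair_ring_induct)
      case (diff f f') then show ?case unfolding pair_mult_diff by (intro df)
    qed (use of in auto)
  qed auto
  have as: "f \<otimes>\<^bsub>?F\<^esub> g \<otimes>\<^bsub>?F\<^esub> h = f \<otimes>\<^bsub>?F\<^esub> (g \<otimes>\<^bsub>?F\<^esub> h)"
    if "Poly_Mapping.keys f \<subseteq> ?K" "Poly_Mapping.keys g \<subseteq> ?K" "Poly_Mapping.keys h \<subseteq> ?K" for f g h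
    using that(1)
  proof (induction f rule: pair_ring_induct)
    case (of a b)
    from that(2) show ?case
    proof (induction g rule: pair_ring_induct)
      case (of a' b')
      from that(3) show ?case
        by (induction h rule: pair_ring_induct)
          (use of \<open>a \<in> carrier A\<close> \<open>b \<in> carrier B\<close> in \<open>auto simp: pair_mult_diff A.m_assoc B.m_assoc\<close>)
    qed (auto simp: pair_mult_diff)
  qed (auto simp: pair_mult_diff)
  have one: "\<one>\<^bsub>?F\<^esub> \<otimes>\<^bsub>?F\<^esub> f = f" "f \<otimes>\<^bsub>?F\<^esub> \<one>\<^bsub>?F\<^esub> = f" if "Poly_Mapping.keys f \<subseteq> ?K" for f
    using that by (induction f rule: pair_ring_induct) (auto simp: pair_mult_diff)
  show ?thesis
  proof (intro ringI abelian_groupI monoidI, goal_cases)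
    case (1 x y) then show ?case using keys_add[of x y] by auto
  next
    case (6 x) then show ?case by (auto intro!: bexI[of _ "- x"])
  next
    case (7 x y) then show ?case using cl by (simp only: pair_ring_simps)
  next
    case (9 x y z) then show ?case using as by (simp only: pair_ring_simps)
  next
    case (10 x) then show ?case using one(1) by (simp only: pair_ring_simps)
  next
    case (11 x) then show ?case using one(2) by (simp only: pair_ring_simps)
  next
    case (12 x y z) show ?case by (simp only: pair_ring_simps pair_mult_add)
  next
    case (13 x y z) show ?case by (simp only: pair_ring_simps pair_mult_add)
  qed (simp_all add: ac_simps)
qed

end

lemma ideal_tensor_relations:
  assumes "assoc_algebra R A" "assoc_algebra R B"
  shows "ideal (tensor_relations R A B) (pair_ring A B)"
proof -
  interpret A: assoc_algebra R A by fact
  interpret B: assoc_algebra R B by fact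
  let ?F = "pair_ring A B" and ?T = "tensor_relations R A B" and ?G = "tensor_generators R A B"
  interpret F: ring ?F by (rule ring_pair_ring) (rule A.ring_axioms, rule B.ring_axioms)
  have GF: "?G \<subseteq> carrier ?F"
  proof -
    have "frag_of (a, b) \<in> carrier ?F" if "a \<in> carrier A" "b \<in> carrier B" for a b
      using that by simp
    moreover have "f - g \<in> carrier ?F" if "f \<in> carrier ?F" "g \<in> carrier ?F" for f g
      using that keys_diff[of f g] by auto
    ultimately show ?thesis
      unfolding tensor_generators_def by (auto simp del: pair_ring_simps)
  qed
  have sg: "subgroup ?T (add_monoid ?F)"
    unfolding tensor_relations_def using GF by (intro F.add.generate_is_subgroup) simp
  have neg: "\<ominus>\<^bsub>?F\<^esub> f = - f" if "f \<in> carrier ?F" for f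
    using that by (intro F.minus_equality) auto
  have Td: "f - g \<in> ?T" if "f \<in> ?T" "g \<in> ?T" for f g
  proof -
    have "g \<in> carrier ?F" using subgroup.mem_carrier[OF sg that(2)] by simp
    then have "- g \<in> ?T" using subgroup.m_inv_closed[OF sg that(2)] neg by (simp add: a_inv_def)
    then show ?thesis using subgroup.m_closed[OF sg that(1), of "- g"] by simp
  qed
  have T0: "0 \<in> ?T" using subgroup.one_closed[OF sg] by simp
  have gi: "g \<in> ?G \<Longrightarrow> g \<in> ?T" for g
    unfolding tensor_relations_def by (rule generate.incl)
  have G1: "frag_of (u \<oplus>\<^bsub>A\<^esub> u', v) - frag_of (u, v) - frag_of (u', v) \<in> ?G"
    if "u \<in> carrier A" "u' \<in> carrier A" "v \<in> carrier B" for u u' v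
    using that unfolding tensor_generators_def by blast
  have G2: "frag_of (u, v \<oplus>\<^bsub>B\<^esub> v') - frag_of (u, v) - frag_of (u, v') \<in> ?G"
    if "u \<in> carrier A" "v \<in> carrier B" "v' \<in> carrier B" for u v v'
    using that unfolding tensor_generators_def by blast
  have G3: "frag_of (r \<odot>\<^bsub>A\<^esub> u, v) - frag_of (u, r \<odot>\<^bsub>B\<^esub> v) \<in> ?G"
    if "r \<in> carrier R" "u \<in> carrier A" "v \<in> carrier B" for r u v
    using that unfolding tensor_generators_def by blast
  have Gof: "frag_of (a, b) \<otimes>\<^bsub>?F\<^esub> g \<in> ?T \<and> g \<otimes>\<^bsub>?F\<^esub> frag_of (a, b) \<in> ?T"
    if ab: "a \<in> carrier A" "b \<in> carrier B" and g: "g \<in> ?G" for a b g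
  proof -
    consider (1) u u' v where "g = frag_of (u \<oplus>\<^bsub>A\<^esub> u', v) - frag_of (u, v) - frag_of (u', v)"
        "u \<in> carrier A" "u' \<in> carrier A" "v \<in> carrier B"
      | (2) u v v' where "g = frag_of (u, v \<oplus>\<^bsub>B\<^esub> v') - frag_of (u, v) - frag_of (u, v')"
        "u \<in> carrier A" "v \<in> carrier B" "v' \<in> carrier B"
      | (3) r u v where "g = frag_of (r \<odot>\<^bsub>A\<^esub> u, v) - frag_of (u, r \<odot>\<^bsub>B\<^esub> v)"
        "r \<in> carrier R" "u \<in> carrier A" "v \<in> carrier B"
      using g unfolding tensor_generators_def by blast
    then have "frag_of (a, b) \<otimes>\<^bsub>?F\<^esub> g \<in> ?G \<and> g \<otimes>\<^bsub>?F\<^esub> frag_of (a, b) \<in> ?G"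
    proof cases
      case 1
      then show ?thesis using ab
        by (simp add: pair_mult_diff A.r_distr A.l_distr G1)
    next
      case 2
      then show ?thesis using ab
        by (simp add: pair_mult_diff B.r_distr B.l_distr G2)
    next
      case 3
      then show ?thesis using ab G3[of r "a \<otimes>\<^bsub>A\<^esub> u" "b \<otimes>\<^bsub>B\<^esub> v"] G3[of r "u \<otimes>\<^bsub>A\<^esub> a" "v \<otimes>\<^bsub>B\<^esub> b"]
        by (simp add: pair_mult_diff A.smult_mult_left A.smult_mult_right B.smult_mult_left
            B.smult_mult_right)
    qed
    then show ?thesis using gi by blast
  qed
  have Gx: "x \<otimes>\<^bsub>?F\<^esub> g \<in> ?T \<and> g \<otimes>\<^bsub>?F\<^esub> x \<in> ?T" if "x \<in> carrier ?F" "g \<in> ?G" for x g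
  proof -
    have "Poly_Mapping.keys x \<subseteq> carrier A \<times> carrier B" using that by simp
    then show ?thesis
      by (induction x rule: pair_ring_induct) (use T0 Gof that(2) in \<open>auto simp: pair_mult_diff Td\<close>)
  qed
  have Tx: "x \<otimes>\<^bsub>?F\<^esub> f \<in> ?T \<and> f \<otimes>\<^bsub>?F\<^esub> x \<in> ?T" if f: "f \<in> ?T" and x: "x \<in> carrier ?F" for x f
  proof -
    have "f \<in> generate (add_monoid ?F) ?G" using f by (simp only: tensor_relations_def)
    then show ?thesis
    proof (induction f rule: generate.induct)
      case one then show ?case using T0 by simp
    next
      case (incl h) then show ?case using Gx[OF x] by simp
    next
      case (inv h)
      then have "h \<in> carrier ?F" using GF by blast
      then have eq: "inv\<^bsub>add_monoid ?F\<^esub> h = 0 - h" using neg by (simp add: a_inv_def)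
      have "0 - x \<otimes>\<^bsub>?F\<^esub> h \<in> ?T" "0 - h \<otimes>\<^bsub>?F\<^esub> x \<in> ?T"
        using Gx[OF x inv] by (blast intro: Td T0)+
      then show ?case unfolding eq pair_mult_diff pair_mult_zero by blast
    next
      case (eng h1 h2)
      then have "x \<otimes>\<^bsub>?F\<^esub> h1 + x \<otimes>\<^bsub>?F\<^esub> h2 \<in> ?T" "h1 \<otimes>\<^bsub>?F\<^esub> x + h2 \<otimes>\<^bsub>?F\<^esub> x \<in> ?T"
        using subgroup.m_closed[OF sg] by simp_all
      then show ?case by (simp add: pair_mult_add)
    qed
  qed
  show ?thesis
    by (rule idealI) (use F.ring_axioms sg Tx in auto)
qed

lemma ring_tensor_ring:
  assumes "assoc_algebra R A" "assoc_algebra R B"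
  shows "ring (tensor_ring R A B)"
  unfolding tensor_ring_def using ideal_tensor_relations[OF assms] by (rule ideal.quotient_is_ring)

lemma ring_enveloping_algebra: "assoc_algebra R A \<Longrightarrow> ring (enveloping_algebra R A)"
  unfolding enveloping_algebra_def by (intro ring_tensor_ring assoc_algebra_opposite)


lemma pair_action_closed:
  assumes "ring A" "Poly_Mapping.keys f \<subseteq> carrier A \<times> carrier A" "x \<in> carrier A"
  shows "pair_action A f x \<in> carrier A"
proof -
  interpret ring A by fact
  show ?thesis unfolding pair_action_def using assms(2,3)
    by (intro finsum_closed) (auto intro!: add.int_pow_closed)
qed

lemma add_pow_zero: "add_pow A (0::int) y = \<zero>\<^bsub>A\<^esub>"
  using int_pow_0[of "add_monoid A" y] by (simp add: add_pow_def)

lemma pair_action_superset: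
  assumes "ring A" "S \<subseteq> carrier A \<times> carrier A" "x \<in> carrier A" "finite S" "Poly_Mapping.keys f \<subseteq> S"
  shows "pair_action A f x =
    (\<Oplus>\<^bsub>A\<^esub>p\<in>S. add_pow A (Poly_Mapping.lookup f p) (fst p \<otimes>\<^bsub>A\<^esub> x \<otimes>\<^bsub>A\<^esub> snd p))"
proof -
  interpret ring A by fact
  show ?thesis unfolding pair_action_def using assms(2-)
    by (intro add.finprod_mono_neutral_cong_left) (auto simp: in_keys_iff add_pow_zero intro!: add.int_pow_closed)
qed

lemma pair_action_add:
  assumes "ring A" "Poly_Mapping.keys f \<subseteq> carrier A \<times> carrier A"
    "Poly_Mapping.keys g \<subseteq> carrier A \<times> carrier A" "x \<in> carrier A"
  shows "pair_action A (f + g) x = pair_action A f x \<oplus>\<^bsub>A\<^esub> pair_action A g x"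
proof -
  interpret ring A by fact
  let ?S = "Poly_Mapping.keys f \<union> Poly_Mapping.keys g"
  have S: "?S \<subseteq> carrier A \<times> carrier A" "finite ?S" using assms by auto
  have c: "fst p \<otimes>\<^bsub>A\<^esub> x \<otimes>\<^bsub>A\<^esub> snd p \<in> carrier A" if "p \<in> ?S" for p
    using that S assms(4) by auto
  have *: "pair_action A h x =
      (\<Oplus>\<^bsub>A\<^esub>p\<in>?S. add_pow A (Poly_Mapping.lookup h p) (fst p \<otimes>\<^bsub>A\<^esub> x \<otimes>\<^bsub>A\<^esub> snd p))"
    if "Poly_Mapping.keys h \<subseteq> ?S" for h
    using pair_action_superset[OF assms(1) S(1) assms(4) S(2) that] .
  have "pair_action A (f + g) x =
      (\<Oplus>\<^bsub>A\<^esub>p\<in>?S. add_pow A (Poly_Mapping.lookup f p) (fst p \<otimes>\<^bsub>A\<^esub> x \<otimes>\<^bsub>A\<^esub> snd p)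
        \<oplus>\<^bsub>A\<^esub> add_pow A (Poly_Mapping.lookup g p) (fst p \<otimes>\<^bsub>A\<^esub> x \<otimes>\<^bsub>A\<^esub> snd p))"
    unfolding *[OF keys_add]
    by (intro finsum_cong') (auto simp: lookup_add add.int_pow_mult c intro!: add.int_pow_closed)
  also have "\<dots> = pair_action A f x \<oplus>\<^bsub>A\<^esub> pair_action A g x"
    using c by (subst finsum_addf) (auto simp: * intro!: add.int_pow_closed)
  finally show ?thesis .
qed

lemma pair_action_of [simp]:
  assumes "ring A" "a \<in> carrier A" "b \<in> carrier A" "x \<in> carrier A"
  shows "pair_action A (frag_of (a, b)) x = a \<otimes>\<^bsub>A\<^esub> x \<otimes>\<^bsub>A\<^esub> b"
proof -
  interpret ring A by fact
  show ?thesis using assms(2-)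
    by (simp add: pair_action_def add.int_pow_1 finsum_insert[of "{}", simplified])
qed

lemma pair_action_zero [simp]:
  assumes "ring A" shows "pair_action A 0 x = \<zero>\<^bsub>A\<^esub>"
proof -
  interpret ring A by fact
  show ?thesis by (simp add: pair_action_def)
qed

lemma pair_action_diff:
  assumes "ring A" "Poly_Mapping.keys f \<subseteq> carrier A \<times> carrier A"
    "Poly_Mapping.keys g \<subseteq> carrier A \<times> carrier A" "x \<in> carrier A"
  shows "pair_action A (f - g) x = pair_action A f x \<ominus>\<^bsub>A\<^esub> pair_action A g x"
proof -
  interpret ring A by fact
  have k: "Poly_Mapping.keys (f - g) \<subseteq> carrier A \<times> carrier A"
    using keys_diff[of f g] assms(2,3) by auto
  have "pair_action A f x = pair_action A (f - g) x \<oplus>\<^bsub>A\<^esub> pair_action A g x"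
    using pair_action_add[OF assms(1) k assms(3,4)] by simp
  then show ?thesis
    using pair_action_closed[OF assms(1) k assms(4)] pair_action_closed[OF assms(1,3,4)]
    by (simp add: minus_eq a_assoc r_neg)
qed

lemma pair_action_add_right:
  assumes "ring A" "Poly_Mapping.keys f \<subseteq> carrier A \<times> carrier A" "x \<in> carrier A" "y \<in> carrier A"
  shows "pair_action A f (x \<oplus>\<^bsub>A\<^esub> y) = pair_action A f x \<oplus>\<^bsub>A\<^esub> pair_action A f y"
proof -
  interpret ring A by fact
  show ?thesis using assms(2)
  proof (induction f rule: pair_ring_induct)
    case zero show ?case using assms(1,3,4) by simp
  next
    case (diff f g)
    note d = pair_action_diff[OF assms(1) diff(1,2)]
    note cl = pair_action_closed[OF assms(1) diff(1)] pair_action_closed[OF assms(1) diff(2)]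
    show ?case using assms(3,4) diff(3,4) cl
      by (simp add: d minus_eq minus_add a_ac)
  next
    case (of a b) then show ?case using assms by (simp add: r_distr l_distr)
  qed
qed

lemma pair_action_mult:
  assumes A: "assoc_algebra R A" and f: "Poly_Mapping.keys f \<subseteq> carrier A \<times> carrier A"
    and g: "Poly_Mapping.keys g \<subseteq> carrier A \<times> carrier A" and x: "x \<in> carrier A"
  shows "pair_action A (f \<otimes>\<^bsub>pair_ring A (opposite_algebra A)\<^esub> g) x = pair_action A f (pair_action A g x)"
proof -
  interpret A: assoc_algebra R A by fact
  interpret O: assoc_algebra R "opposite_algebra A" using A by (rule assoc_algebra_opposite)
  let ?F = "pair_ring A (opposite_algebra A)"
  have rA: "ring A" by (rule A.ring_axioms)
  interpret F: ring ?F by (rule ring_pair_ring[OF rA O.ring_axioms])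
  have O: "carrier (opposite_algebra A) = carrier A" "a \<otimes>\<^bsub>opposite_algebra A\<^esub> b = b \<otimes>\<^bsub>A\<^esub> a" for a b
    by (simp_all add: opposite_algebra_def)
  have cl: "Poly_Mapping.keys (f \<otimes>\<^bsub>?F\<^esub> g) \<subseteq> carrier A \<times> carrier A"
    if "Poly_Mapping.keys f \<subseteq> carrier A \<times> carrier A" "Poly_Mapping.keys g \<subseteq> carrier A \<times> carrier A" for f g
    using F.m_closed[of f g] that by (simp add: O)
  note ac = pair_action_closed[OF rA]
  from f show ?thesis
  proof (induction f rule: pair_ring_induct)
    case zero show ?case using rA by simp
  next
    case (diff f f')
    show ?case unfolding pair_mult_diff
      using diff cl[OF diff(1) g] cl[OF diff(2) g] x ac[OF g x] by (simp add: pair_action_diff[OF rA])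
  next
    case (of a b)
    from g show ?case
    proof (induction g rule: pair_ring_induct)
      case zero show ?case using rA of by simp
    next
      case (diff g g')
      have k: "Poly_Mapping.keys (frag_of (a, b)) \<subseteq> carrier A \<times> carrier A" using of by simp
      show ?case unfolding pair_mult_diff
        using diff of cl[OF k diff(1)] cl[OF k diff(2)] x ac[OF diff(1) x] ac[OF diff(2) x] rA
        by (simp add: pair_action_diff A.minus_eq A.l_distr A.r_distr A.l_minus A.r_minus)
    next
      case (of a' b')
      then show ?case using \<open>a \<in> carrier A\<close> \<open>b \<in> carrier A\<close> x rA
        by (simp add: O A.m_assoc)
    qed
  qed
qed

lemma pair_action_relations:
  assumes A: "assoc_algebra R A" and f: "f \<in> tensor_relations R A (opposite_algebra A)"
    and x: "x \<in> carrier A"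
  shows "pair_action A f x = \<zero>\<^bsub>A\<^esub>"
proof -
  interpret A: assoc_algebra R A by fact
  have oa: "assoc_algebra R (opposite_algebra A)" using A by (rule assoc_algebra_opposite)
  let ?F = "pair_ring A (opposite_algebra A)" and ?G = "tensor_generators R A (opposite_algebra A)"
  have rA: "ring A" by (rule A.ring_axioms)
  have O: "carrier (opposite_algebra A) = carrier A" "add (opposite_algebra A) = add A"
    "smult (opposite_algebra A) = smult A"
    by (simp_all add: opposite_algebra_def)
  interpret T: ideal "tensor_relations R A (opposite_algebra A)" ?F
    by (rule ideal_tensor_relations[OF A oa])
  have key: "Poly_Mapping.keys h \<subseteq> carrier A \<times> carrier A" if "h \<in> tensor_relations R A (opposite_algebra A)" for h
    using T.a_subset that by (auto simp: O subset_eq)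
  have k2: "Poly_Mapping.keys (u - v) \<subseteq> carrier A \<times> carrier A"
    if "Poly_Mapping.keys u \<subseteq> carrier A \<times> carrier A" "Poly_Mapping.keys v \<subseteq> carrier A \<times> carrier A" for u v
    using that keys_diff[of u v] by blast
  have G: "pair_action A h x = \<zero>\<^bsub>A\<^esub>" if "h \<in> ?G" for h
  proof -
    from that consider (1) u u' v where "h = frag_of (u \<oplus>\<^bsub>A\<^esub> u', v) - frag_of (u, v) - frag_of (u', v)"
        "u \<in> carrier A" "u' \<in> carrier A" "v \<in> carrier A"
      | (2) u v v' where "h = frag_of (u, v \<oplus>\<^bsub>A\<^esub> v') - frag_of (u, v) - frag_of (u, v')"
        "u \<in> carrier A" "v \<in> carrier A" "v' \<in> carrier A"
      | (3) r u v where "h = frag_of (r \<odot>\<^bsub>A\<^esub> u, v) - frag_of (u, r \<odot>\<^bsub>A\<^esub> v)"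
        "r \<in> carrier R" "u \<in> carrier A" "v \<in> carrier A"
      unfolding tensor_generators_def O by blast
    then show ?thesis
    proof cases
      case 1
      then show ?thesis using x rA
        by (simp add: pair_action_diff k2 A.l_distr A.minus_eq A.a_ac A.r_neg A.minus_add A.r_neg1 A.r_neg2)
    next
      case 2
      then show ?thesis using x rA
        by (simp add: pair_action_diff k2 A.r_distr A.minus_eq A.a_ac A.r_neg A.minus_add A.r_neg1 A.r_neg2)
    next
      case 3
      then show ?thesis using x rA
        by (simp add: pair_action_diff A.smult_mult_left A.smult_mult_right A.minus_eq A.r_neg)
    qed
  qed
  have "f \<in> generate (add_monoid ?F) ?G" using f by (simp only: tensor_relations_def)
  then show ?thesis
  proof (induction f rule: generate.induct)
    case one show ?case using rA by simp
  next
    case (incl h) then show ?case by (rule G)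
  next
    case (inv h)
    then have hT: "h \<in> tensor_relations R A (opposite_algebra A)"
      unfolding tensor_relations_def by (rule generate.incl)
    have "\<ominus>\<^bsub>?F\<^esub> h = - h"
      using key[OF hT] by (intro T.minus_equality) (auto simp: O)
    then have "inv\<^bsub>add_monoid ?F\<^esub> h = 0 - h" by (simp add: a_inv_def)
    moreover have "pair_action A (0 - h) x = \<zero>\<^bsub>A\<^esub>"
      using pair_action_diff[OF rA _ key[OF hT] x, of 0] G[OF inv] rA by (simp add: A.minus_eq)
    ultimately show ?case by simp
  next
    case (eng h1 h2)
    have "h1 \<in> tensor_relations R A (opposite_algebra A)" "h2 \<in> tensor_relations R A (opposite_algebra A)"
      using eng by (simp_all only: tensor_relations_def)
    then show ?case using eng.IH pair_action_add[OF rA key key x, of h1 h2] by simp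
  qed
qed

lemma smult_regular_bimodule_coset:
  assumes A: "assoc_algebra R A" and f: "Poly_Mapping.keys f \<subseteq> carrier A \<times> carrier A"
    and x: "x \<in> carrier A"
  shows "(tensor_relations R A (opposite_algebra A) +>\<^bsub>pair_ring A (opposite_algebra A)\<^esub> f)
    \<odot>\<^bsub>regular_bimodule A\<^esub> x = pair_action A f x"
proof -
  interpret A: assoc_algebra R A by fact
  have oa: "assoc_algebra R (opposite_algebra A)" using A by (rule assoc_algebra_opposite)
  let ?F = "pair_ring A (opposite_algebra A)" and ?T = "tensor_relations R A (opposite_algebra A)"
  have rA: "ring A" by (rule A.ring_axioms)
  interpret T: ideal ?T ?F by (rule ideal_tensor_relations[OF A oa])
  have key: "Poly_Mapping.keys h \<subseteq> carrier A \<times> carrier A" if "h \<in> ?T" for h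
    using T.a_subset that by (auto simp: opposite_algebra_def subset_eq)
  have "pair_action A (h + f) x = pair_action A f x" if "h \<in> ?T" for h
    using pair_action_add[OF rA key[OF that] f x] pair_action_relations[OF A that x]
      pair_action_closed[OF rA f x] by simp
  then have "(\<lambda>g. pair_action A g x) ` (?T +>\<^bsub>?F\<^esub> f) = {pair_action A f x}"
    using additive_subgroup.zero_closed[OF T.is_additive_subgroup] by (auto simp: a_r_coset_def' image_iff)
  then show ?thesis by (simp add: regular_bimodule_def)
qed

lemma smult_regular_bimodule_pure:
  assumes "assoc_algebra R A" "a \<in> carrier A" "b \<in> carrier A" "x \<in> carrier A"
  shows "pure_tensor R A (opposite_algebra A) a b \<odot>\<^bsub>regular_bimodule A\<^esub> x = a \<otimes>\<^bsub>A\<^esub> x \<otimes>\<^bsub>A\<^esub> b"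
proof -
  interpret A: assoc_algebra R A by fact
  show ?thesis
    using smult_regular_bimodule_coset[OF assms(1), of "frag_of (a, b)" x] assms A.ring_axioms
    by (simp add: pure_tensor_def)
qed

lemma left_module_regular_bimodule:
  assumes A: "assoc_algebra R A"
  shows "left_module (enveloping_algebra R A) (regular_bimodule A)"
proof -
  interpret A: assoc_algebra R A by fact
  have oa: "assoc_algebra R (opposite_algebra A)" using A by (rule assoc_algebra_opposite)
  let ?F = "pair_ring A (opposite_algebra A)" and ?T = "tensor_relations R A (opposite_algebra A)"
  let ?E = "enveloping_algebra R A" and ?M = "regular_bimodule A"
  have rA: "ring A" by (rule A.ring_axioms)
  interpret T: ideal ?T ?F by (rule ideal_tensor_relations[OF A oa])
  have E: "?E = ?F Quot ?T" by (simp add: enveloping_algebra_def tensor_ring_def)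
  note h = T.rcos_ring_hom[folded E]
  have Fc: "f \<in> carrier ?F \<longleftrightarrow> Poly_Mapping.keys f \<subseteq> carrier A \<times> carrier A" for f
    by (simp add: opposite_algebra_def)
  have ex: "\<exists>f. f \<in> carrier ?F \<and> t = ?T +>\<^bsub>?F\<^esub> f" if "t \<in> carrier ?E" for t
    using that by (auto simp: E FactRing_def A_RCOSETS_def' simp del: pair_ring_simps)
  note sm = smult_regular_bimodule_coset[OF A, folded Fc]
  note ac = pair_action_closed[OF rA, folded Fc]
  have M: "carrier ?M = carrier A" "add ?M = add A" "\<zero>\<^bsub>?M\<^esub> = \<zero>\<^bsub>A\<^esub>"
    by (simp_all add: regular_bimodule_def)
  show ?thesis
  proof (intro left_module.intro left_module_axioms.intro ring_enveloping_algebra[OF A])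
    show "abelian_group ?M"
    proof (rule abelian_groupI, goal_cases)
      case (6 x) then show ?case by (auto simp: M intro!: bexI[of _ "\<ominus>\<^bsub>A\<^esub> x"] A.l_neg)
    qed (auto simp: M A.a_ac)
    show "a \<odot>\<^bsub>?M\<^esub> x \<in> carrier ?M" if "a \<in> carrier ?E" "x \<in> carrier ?M" for a x
      using ex[OF that(1)] that(2) sm ac unfolding M by metis
    show "(a \<oplus>\<^bsub>?E\<^esub> b) \<odot>\<^bsub>?M\<^esub> x = a \<odot>\<^bsub>?M\<^esub> x \<oplus>\<^bsub>?M\<^esub> b \<odot>\<^bsub>?M\<^esub> x"
      if a: "a \<in> carrier ?E" and b: "b \<in> carrier ?E" and x: "x \<in> carrier ?M" for a b x
    proof -
      obtain f g where f: "f \<in> carrier ?F" "a = ?T +>\<^bsub>?F\<^esub> f" and g: "g \<in> carrier ?F" "b = ?T +>\<^bsub>?F\<^esub> g"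
        using ex[OF a] ex[OF b] by blast
      have "a \<oplus>\<^bsub>?E\<^esub> b = ?T +>\<^bsub>?F\<^esub> (f \<oplus>\<^bsub>?F\<^esub> g)"
        unfolding f g by (rule ring_hom_add[OF h f(1) g(1), symmetric])
      then show ?thesis
        using f g sm[OF T.add.m_closed[OF f(1) g(1)]] sm[OF f(1)] sm[OF g(1)] x pair_action_add[OF rA, of f g x]
        unfolding M Fc by (simp add: Fc)
    qed
    show "a \<odot>\<^bsub>?M\<^esub> (x \<oplus>\<^bsub>?M\<^esub> y) = a \<odot>\<^bsub>?M\<^esub> x \<oplus>\<^bsub>?M\<^esub> a \<odot>\<^bsub>?M\<^esub> y"
      if a: "a \<in> carrier ?E" and x: "x \<in> carrier ?M" "y \<in> carrier ?M" for a x y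
    proof -
      obtain f where f: "f \<in> carrier ?F" "a = ?T +>\<^bsub>?F\<^esub> f"
        using ex[OF a] by blast
      then show ?thesis
        using x sm[OF f(1)] pair_action_add_right[OF rA, of f x y] unfolding M Fc by simp
    qed
    show "(a \<otimes>\<^bsub>?E\<^esub> b) \<odot>\<^bsub>?M\<^esub> x = a \<odot>\<^bsub>?M\<^esub> (b \<odot>\<^bsub>?M\<^esub> x)"
      if a: "a \<in> carrier ?E" and b: "b \<in> carrier ?E" and x: "x \<in> carrier ?M" for a b x
    proof -
      obtain f g where f: "f \<in> carrier ?F" "a = ?T +>\<^bsub>?F\<^esub> f" and g: "g \<in> carrier ?F" "b = ?T +>\<^bsub>?F\<^esub> g"
        using ex[OF a] ex[OF b] by blast
      have "a \<otimes>\<^bsub>?E\<^esub> b = ?T +>\<^bsub>?F\<^esub> (f \<otimes>\<^bsub>?F\<^esub> g)"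
        unfolding f g by (rule ring_hom_mult[OF h f(1) g(1), symmetric])
      then show ?thesis
        using f g sm[OF T.m_closed[OF f(1) g(1)]] sm[OF f(1)] sm[OF g(1)] x
          ac[OF g(1)] pair_action_mult[OF A, folded Fc, OF f(1) g(1)]
        unfolding M by simp
    qed
    show "\<one>\<^bsub>?E\<^esub> \<odot>\<^bsub>?M\<^esub> x = x" if "x \<in> carrier ?M" for x
    proof -
      have "\<one>\<^bsub>?E\<^esub> = ?T +>\<^bsub>?F\<^esub> frag_of (\<one>\<^bsub>A\<^esub>, \<one>\<^bsub>A\<^esub>)"
        by (simp add: E FactRing_def) (simp add: opposite_algebra_def)
      then show ?thesis
        using that smult_regular_bimodule_coset[OF A, of "frag_of (\<one>\<^bsub>A\<^esub>, \<one>\<^bsub>A\<^esub>)" x] rA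
        unfolding M by simp
    qed
  qed
qed

end

theory Submission
  imports Defs
begin

text \<open>
  The projection \<open>\<pi> : (A \<oplus> B)\<^sup>e \<rightarrow> A\<^sup>e\<close> is split by the non-unital map \<open>\<iota>\<close> induced by \<open>a \<mapsto> (a, 0)\<close>, and
  \<open>\<iota> \<pi>\<close> is multiplication by the central idempotent \<open>\<epsilon> = (1, 0) \<otimes> (1, 0)\<close>.  Cutting with \<open>\<epsilon>\<close> is an
  exact functor from \<open>(A \<oplus> B)\<^sup>e\<close>-modules to \<open>A\<^sup>e\<close>-modules that sends \<open>A \<oplus> B\<close> to \<open>A\<close>; restriction along
  \<open>\<pi>\<close> is an exact functor the other way, and the restrictions of \<open>A\<close> and \<open>B\<close> sum to \<open>A \<oplus> B\<close>.  Both
  functors preserve finitely generated projective modules, because they carry a finite dual basis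
  \<open>y = \<Sum>i. \<phi> i y \<cdot> x i\<close> to a finite dual basis.
\<close>

section \<open>Finitely generated projective modules and dual bases\<close>

text \<open>The obstacle is one of types. \<open>perfect_module\<close> wants modules with elements
  in \<open>nat \<Rightarrow> 'r\<close>, where \<open>'r\<close> is the element type of the ring,
  and \<open>projective_module\<close> wants a basis inside the element type of the module. The two
  functors keep the elements of a module but change the ring, and direct sums produce pairs, so none
  of them lands in the required type. Both notions are therefore replaced by versions free of such
  restrictions: a finite dual basis indexed by natural numbers, and a resolution with an arbitrary
  element type. The coefficients with respect to a dual basis embed each term back into the
  prescribed type. The enveloping algebra of the product has four blocks,
  \<open>A \<otimes> A\<close>, \<open>A \<otimes> B\<close>, \<open>B \<otimes> A\<close> and
  \<open>B \<otimes> B\<close> (second factors opposite). The mixed blocks act as zero on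
  \<open>A \<oplus> B\<close>, because \<open>(a, 0) x (0, b) = 0\<close>; this is why the two
  restricted bimodules already make up the whole bimodule.\<close>

lemma additive_hom_zero:
  assumes "abelian_group M" "abelian_group N" "h \<in> carrier M \<rightarrow> carrier N"
    and "\<And>x y. \<lbrakk>x \<in> carrier M; y \<in> carrier M\<rbrakk> \<Longrightarrow> h (x \<oplus>\<^bsub>M\<^esub> y) = h x \<oplus>\<^bsub>N\<^esub> h y"
  shows "h \<zero>\<^bsub>M\<^esub> = \<zero>\<^bsub>N\<^esub>"
proof -
  interpret M: abelian_group M by fact
  interpret N: abelian_group N by fact
  have "h \<zero>\<^bsub>M\<^esub> \<in> carrier N" using assms(3) by auto
  moreover have "h \<zero>\<^bsub>M\<^esub> \<oplus>\<^bsub>N\<^esub> h \<zero>\<^bsub>M\<^esub> = h \<zero>\<^bsub>M\<^esub>"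
    using assms(4)[of "\<zero>\<^bsub>M\<^esub>" "\<zero>\<^bsub>M\<^esub>"] by simp
  ultimately show ?thesis using N.add.r_cancel_one' by metis
qed

text \<open>Stated for bare additive maps because it is applied to maps that are not module
  homomorphisms: \<open>r \<mapsto> r \<odot> x\<close> from the ring to a module, a single
  coordinate of a function-valued map, and the identity between two records that share carrier and
  addition.\<close>

lemma additive_hom_finsum:
  assumes "abelian_group M" "abelian_group N" "h \<in> carrier M \<rightarrow> carrier N"
    and "\<And>x y. \<lbrakk>x \<in> carrier M; y \<in> carrier M\<rbrakk> \<Longrightarrow> h (x \<oplus>\<^bsub>M\<^esub> y) = h x \<oplus>\<^bsub>N\<^esub> h y"
    and "finite I" "f \<in> I \<rightarrow> carrier M"
  shows "h (finsum M f I) = (\<Oplus>\<^bsub>N\<^esub>i\<in>I. h (f i))"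
proof -
  interpret M: abelian_group M by fact
  interpret N: abelian_group N by fact
  have h0: "h \<zero>\<^bsub>M\<^esub> = \<zero>\<^bsub>N\<^esub>" by (rule additive_hom_zero) (use assms in auto)
  have hc: "h x \<in> carrier N" if "x \<in> carrier M" for x using assms(3) that by auto
  show ?thesis using assms(5,6)
  proof (induction I rule: finite_induct)
    case empty then show ?case by (simp add: h0)
  next
    case (insert i I)
    have "f i \<in> carrier M" "f \<in> I \<rightarrow> carrier M" using insert.prems by auto
    then show ?case using insert.hyps insert.IH
      by (simp add: assms(4) hc Pi_def)
  qed
qed

context left_module
begin

lemma smult_r_null [simp]:
  assumes "a \<in> carrier R" shows "a \<odot>\<^bsub>M\<^esub> \<zero>\<^bsub>M\<^esub> = \<zero>\<^bsub>M\<^esub>"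
  by (rule additive_hom_zero[OF M.abelian_group_axioms M.abelian_group_axioms])
    (use assms smult_r_distr in auto)

lemma finsum_smult_right:
  assumes "a \<in> carrier R" "finite I" "f \<in> I \<rightarrow> carrier M"
  shows "a \<odot>\<^bsub>M\<^esub> finsum M f I = (\<Oplus>\<^bsub>M\<^esub>i\<in>I. a \<odot>\<^bsub>M\<^esub> f i)"
  by (rule additive_hom_finsum[OF M.abelian_group_axioms M.abelian_group_axioms])
    (use assms smult_r_distr in auto)

lemma finsum_smult_left:
  assumes "x \<in> carrier M" "finite I" "f \<in> I \<rightarrow> carrier R"
  shows "finsum R f I \<odot>\<^bsub>M\<^esub> x = (\<Oplus>\<^bsub>M\<^esub>i\<in>I. f i \<odot>\<^bsub>M\<^esub> x)"
  by (rule additive_hom_finsum[OF R.abelian_group_axioms M.abelian_group_axioms, where h = "\<lambda>r. r \<odot>\<^bsub>M\<^esub> x"])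
    (use assms smult_l_distr in auto)

end

section \<open>Homomorphisms, linear functionals and dual bases\<close>

lemma left_module_homD:
  assumes "h \<in> left_module_hom R M N"
  shows "x \<in> carrier M \<Longrightarrow> h x \<in> carrier N"
    and "\<lbrakk>x \<in> carrier M; y \<in> carrier M\<rbrakk> \<Longrightarrow> h (x \<oplus>\<^bsub>M\<^esub> y) = h x \<oplus>\<^bsub>N\<^esub> h y"
    and "\<lbrakk>r \<in> carrier R; x \<in> carrier M\<rbrakk> \<Longrightarrow> h (r \<odot>\<^bsub>M\<^esub> x) = r \<odot>\<^bsub>N\<^esub> h x"
  using assms by (auto simp: left_module_hom_def)

lemma left_module_homI:
  assumes "\<And>x. x \<in> carrier M \<Longrightarrow> h x \<in> carrier N"
    and "\<And>x y. \<lbrakk>x \<in> carrier M; y \<in> carrier M\<rbrakk> \<Longrightarrow> h (x \<oplus>\<^bsub>M\<^esub> y) = h x \<oplus>\<^bsub>N\<^esub> h y"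
    and "\<And>r x. \<lbrakk>r \<in> carrier R; x \<in> carrier M\<rbrakk> \<Longrightarrow> h (r \<odot>\<^bsub>M\<^esub> x) = r \<odot>\<^bsub>N\<^esub> h x"
  shows "h \<in> left_module_hom R M N"
  using assms by (auto simp: left_module_hom_def)

lemma left_module_hom_zero:
  assumes "left_module R M" "left_module R N" "h \<in> left_module_hom R M N"
  shows "h \<zero>\<^bsub>M\<^esub> = \<zero>\<^bsub>N\<^esub>"
  by (rule additive_hom_zero)
    (use assms left_module_homD[OF assms(3)] in \<open>auto simp: left_module_def\<close>)

text \<open>The dual module Hom(M, R). It is spelled out instead of using
  \<open>left_module_hom\<close>, whose target is a module record, whereas \<open>R\<close> is only
  a ring record acting on itself by multiplication.\<close>

definition linear_functionals ::
    "('r, 'x) ring_scheme \<Rightarrow> ('r, 'm, 'y) module_scheme \<Rightarrow> ('m \<Rightarrow> 'r) set"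
  where "linear_functionals R M =
    {\<phi> \<in> carrier M \<rightarrow> carrier R.
       (\<forall>x\<in>carrier M. \<forall>y\<in>carrier M. \<phi> (x \<oplus>\<^bsub>M\<^esub> y) = \<phi> x \<oplus>\<^bsub>R\<^esub> \<phi> y) \<and>
       (\<forall>r\<in>carrier R. \<forall>x\<in>carrier M. \<phi> (r \<odot>\<^bsub>M\<^esub> x) = r \<otimes>\<^bsub>R\<^esub> \<phi> x)}"

lemma linear_functionalsD:
  assumes "\<phi> \<in> linear_functionals R M"
  shows "x \<in> carrier M \<Longrightarrow> \<phi> x \<in> carrier R"
    and "\<lbrakk>x \<in> carrier M; y \<in> carrier M\<rbrakk> \<Longrightarrow> \<phi> (x \<oplus>\<^bsub>M\<^esub> y) = \<phi> x \<oplus>\<^bsub>R\<^esub> \<phi> y"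
    and "\<lbrakk>r \<in> carrier R; x \<in> carrier M\<rbrakk> \<Longrightarrow> \<phi> (r \<odot>\<^bsub>M\<^esub> x) = r \<otimes>\<^bsub>R\<^esub> \<phi> x"
  using assms by (auto simp: linear_functionals_def)

lemma linear_functionalsI:
  assumes "\<And>x. x \<in> carrier M \<Longrightarrow> \<phi> x \<in> carrier R"
    and "\<And>x y. \<lbrakk>x \<in> carrier M; y \<in> carrier M\<rbrakk> \<Longrightarrow> \<phi> (x \<oplus>\<^bsub>M\<^esub> y) = \<phi> x \<oplus>\<^bsub>R\<^esub> \<phi> y"
    and "\<And>r x. \<lbrakk>r \<in> carrier R; x \<in> carrier M\<rbrakk> \<Longrightarrow> \<phi> (r \<odot>\<^bsub>M\<^esub> x) = r \<otimes>\<^bsub>R\<^esub> \<phi> x"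
  shows "\<phi> \<in> linear_functionals R M"
  using assms by (auto simp: linear_functionals_def)

text \<open>Serves \<open>dual_basis_of_set\<close>, where the functionals attached to equal
  elements are added up.\<close>

lemma linear_functionals_sum:
  assumes "left_module R M" "finite I" "\<And>i. i \<in> I \<Longrightarrow> \<phi> i \<in> linear_functionals R M"
  shows "(\<lambda>y. \<Oplus>\<^bsub>R\<^esub>i\<in>I. \<phi> i y) \<in> linear_functionals R M"
proof -
  interpret left_module R M by fact
  note D = linear_functionalsD[OF assms(3)]
  show ?thesis
  proof (rule linear_functionalsI)
    fix x assume "x \<in> carrier M"
    then show "(\<Oplus>\<^bsub>R\<^esub>i\<in>I. \<phi> i x) \<in> carrier R" by (auto intro!: R.finsum_closed D)
  next
    fix x y assume xy: "x \<in> carrier M" "y \<in> carrier M"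
    have "(\<Oplus>\<^bsub>R\<^esub>i\<in>I. \<phi> i (x \<oplus>\<^bsub>M\<^esub> y)) = (\<Oplus>\<^bsub>R\<^esub>i\<in>I. \<phi> i x \<oplus>\<^bsub>R\<^esub> \<phi> i y)"
      by (rule R.finsum_cong') (use xy D in auto)
    also have "\<dots> = (\<Oplus>\<^bsub>R\<^esub>i\<in>I. \<phi> i x) \<oplus>\<^bsub>R\<^esub> (\<Oplus>\<^bsub>R\<^esub>i\<in>I. \<phi> i y)"
      by (rule R.finsum_addf) (use xy D in auto)
    finally show "(\<Oplus>\<^bsub>R\<^esub>i\<in>I. \<phi> i (x \<oplus>\<^bsub>M\<^esub> y)) = (\<Oplus>\<^bsub>R\<^esub>i\<in>I. \<phi> i x) \<oplus>\<^bsub>R\<^esub> (\<Oplus>\<^bsub>R\<^esub>i\<in>I. \<phi> i y)" .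
  next
    fix r x assume rx: "r \<in> carrier R" "x \<in> carrier M"
    have "(\<Oplus>\<^bsub>R\<^esub>i\<in>I. \<phi> i (r \<odot>\<^bsub>M\<^esub> x)) = (\<Oplus>\<^bsub>R\<^esub>i\<in>I. r \<otimes>\<^bsub>R\<^esub> \<phi> i x)"
      by (rule R.finsum_cong') (use rx D in auto)
    also have "\<dots> = r \<otimes>\<^bsub>R\<^esub> (\<Oplus>\<^bsub>R\<^esub>i\<in>I. \<phi> i x)"
      by (rule R.finsum_rdistr[symmetric]) (use rx D assms(2) in auto)
    finally show "(\<Oplus>\<^bsub>R\<^esub>i\<in>I. \<phi> i (r \<odot>\<^bsub>M\<^esub> x)) = r \<otimes>\<^bsub>R\<^esub> (\<Oplus>\<^bsub>R\<^esub>i\<in>I. \<phi> i x)" .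
  qed
qed

text \<open>The data of the dual basis lemma. Despite the name, neither independence nor
  orthogonality of \<open>x\<close> and \<open>\<phi>\<close> is asked for: the pair factors the
  identity of \<open>M\<close> through a free module of finite rank. The index type is left open so
  that sets of elements and disjoint sums can serve as index sets.\<close>

definition dual_basis ::
    "('r, 'x) ring_scheme \<Rightarrow> ('r, 'm, 'y) module_scheme \<Rightarrow> 'i set \<Rightarrow> ('i \<Rightarrow> 'm) \<Rightarrow> ('i \<Rightarrow> 'm \<Rightarrow> 'r) \<Rightarrow> bool"
  where "dual_basis R M I x \<phi> \<longleftrightarrow> finite I \<and> x \<in> I \<rightarrow> carrier M \<and>
    \<phi> \<in> I \<rightarrow> linear_functionals R M \<and>
    (\<forall>y\<in>carrier M. (\<Oplus>\<^bsub>M\<^esub>i\<in>I. \<phi> i y \<odot>\<^bsub>M\<^esub> x i) = y)"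

text \<open>Indexing by \<open>{..<n}\<close> keeps the existential quantifier inside one fixed
  index type, while the element type of \<open>M\<close> stays arbitrary.\<close>

definition fgp_module :: "('r, 'x) ring_scheme \<Rightarrow> ('r, 'm, 'y) module_scheme \<Rightarrow> bool"
  where "fgp_module R M \<longleftrightarrow> left_module R M \<and> (\<exists>(n::nat) x \<phi>. dual_basis R M {..<n} x \<phi>)"

text \<open>A bijection from \<open>{..<card I}\<close> renumbers a finite index set of any type, so
  later dual bases may be indexed by whatever is convenient.\<close>

lemma fgp_moduleI:
  assumes M: "left_module R M" and db: "dual_basis R M I x \<phi>"
  shows "fgp_module R M"
proof -
  interpret left_module R M by fact
  from db have I: "finite I" "x \<in> I \<rightarrow> carrier M" "\<phi> \<in> I \<rightarrow> linear_functionals R M"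
    and eq: "\<And>y. y \<in> carrier M \<Longrightarrow> (\<Oplus>\<^bsub>M\<^esub>i\<in>I. \<phi> i y \<odot>\<^bsub>M\<^esub> x i) = y"
    by (auto simp: dual_basis_def)
  obtain h where h: "bij_betw h {..<card I} I"
    using ex_bij_betw_nat_finite[OF I(1)] by (auto simp: atLeast0LessThan)
  then have hi: "h ` {..<card I} = I" "inj_on h {..<card I}" by (auto simp: bij_betw_def)
  have "dual_basis R M {..<card I} (x \<circ> h) (\<phi> \<circ> h)"
    unfolding dual_basis_def
  proof (intro conjI ballI)
    fix y assume y: "y \<in> carrier M"
    have "(\<Oplus>\<^bsub>M\<^esub>i\<in>h ` {..<card I}. \<phi> i y \<odot>\<^bsub>M\<^esub> x i) = (\<Oplus>\<^bsub>M\<^esub>i\<in>{..<card I}. \<phi> (h i) y \<odot>\<^bsub>M\<^esub> x (h i))"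
      by (rule M.add.finprod_reindex) (use hi I y in \<open>auto simp: linear_functionals_def Pi_def\<close>)
    then show "(\<Oplus>\<^bsub>M\<^esub>i\<in>{..<card I}. (\<phi> \<circ> h) i y \<odot>\<^bsub>M\<^esub> (x \<circ> h) i) = y"
      using eq[OF y] by (simp add: hi)
  qed (use hi I in \<open>auto simp: Pi_def\<close>)
  then show ?thesis using M by (auto simp: fgp_module_def)
qed

text \<open>The definitions of projective and finitely generated index by elements of the module
  itself, so indices with the same \<open>x i\<close> have to be merged. Regrouping the sum over the
  fibres of \<open>x\<close> shows that adding their functionals leaves the expansion
  unchanged.\<close>

lemma dual_basis_of_set:
  assumes M: "left_module R M" and db: "dual_basis R M I x \<phi>"
  shows "dual_basis R M (x ` I) (\<lambda>s. s) (\<lambda>s y. \<Oplus>\<^bsub>R\<^esub>i\<in>{i\<in>I. x i = s}. \<phi> i y)"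
proof -
  interpret left_module R M by fact
  from db have I: "finite I" "x \<in> I \<rightarrow> carrier M" "\<And>i. i \<in> I \<Longrightarrow> \<phi> i \<in> linear_functionals R M"
    and eq: "\<And>y. y \<in> carrier M \<Longrightarrow> (\<Oplus>\<^bsub>M\<^esub>i\<in>I. \<phi> i y \<odot>\<^bsub>M\<^esub> x i) = y"
    by (auto simp: dual_basis_def)
  note D = linear_functionalsD[OF I(3)]
  show ?thesis unfolding dual_basis_def
  proof (intro conjI ballI)
    show "(\<lambda>s y. \<Oplus>\<^bsub>R\<^esub>i\<in>{i\<in>I. x i = s}. \<phi> i y) \<in> x ` I \<rightarrow> linear_functionals R M"
      using I by (auto intro!: linear_functionals_sum[OF M])
    fix y assume y: "y \<in> carrier M"
    let ?J = "\<lambda>s. {i\<in>I. x i = s}"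
    have c: "\<phi> i y \<odot>\<^bsub>M\<^esub> x i \<in> carrier M" if "i \<in> I" for i using that I y D by auto
    have "(\<Oplus>\<^bsub>M\<^esub>s\<in>x ` I. (\<Oplus>\<^bsub>R\<^esub>i\<in>?J s. \<phi> i y) \<odot>\<^bsub>M\<^esub> s)
        = (\<Oplus>\<^bsub>M\<^esub>s\<in>x ` I. \<Oplus>\<^bsub>M\<^esub>i\<in>?J s. \<phi> i y \<odot>\<^bsub>M\<^esub> x i)"
    proof (rule M.finsum_cong')
      fix s assume s: "s \<in> x ` I"
      have "(\<Oplus>\<^bsub>R\<^esub>i\<in>?J s. \<phi> i y) \<odot>\<^bsub>M\<^esub> s = (\<Oplus>\<^bsub>M\<^esub>i\<in>?J s. \<phi> i y \<odot>\<^bsub>M\<^esub> s)"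
        by (rule finsum_smult_left) (use s I y D in auto)
      also have "\<dots> = (\<Oplus>\<^bsub>M\<^esub>i\<in>?J s. \<phi> i y \<odot>\<^bsub>M\<^esub> x i)"
        by (rule M.finsum_cong') (use c in auto)
      finally show "(\<Oplus>\<^bsub>R\<^esub>i\<in>?J s. \<phi> i y) \<odot>\<^bsub>M\<^esub> s = (\<Oplus>\<^bsub>M\<^esub>i\<in>?J s. \<phi> i y \<odot>\<^bsub>M\<^esub> x i)" .
    qed (auto intro!: M.finsum_closed c)
    also have "\<dots> = (\<Oplus>\<^bsub>M\<^esub>i\<in>\<Union>(?J ` (x ` I)). \<phi> i y \<odot>\<^bsub>M\<^esub> x i)"
      by (rule M.add.finprod_UN_disjoint[symmetric])
        (use I c in \<open>auto simp: pairwise_def disjnt_def\<close>)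
    also have "\<Union>(?J ` (x ` I)) = I" by auto
    finally show "(\<Oplus>\<^bsub>M\<^esub>s\<in>x ` I. (\<Oplus>\<^bsub>R\<^esub>i\<in>?J s. \<phi> i y) \<odot>\<^bsub>M\<^esub> s) = y"
      using eq[OF y] by simp
  qed (use I in auto)
qed

text \<open>The coefficients of the expansion give a section into the free module on
  \<open>S\<close>, and evaluating formal combinations of elements of \<open>S\<close> gives the
  retraction.\<close>

lemma fgp_module_imp:
  fixes M :: "('r, 'm, 'y) module_scheme"
  assumes "fgp_module R M"
  shows "projective_module R M" "finitely_generated_module R M"
proof -
  have M: "left_module R M" using assms by (simp add: fgp_module_def)
  interpret left_module R M by fact
  obtain S :: "'m set" and \<psi> where "dual_basis R M S (\<lambda>s. s) \<psi>"
    using assms dual_basis_of_set[OF M] by (auto simp: fgp_module_def) blast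
  then have S: "finite S" "S \<subseteq> carrier M" "\<And>s. s \<in> S \<Longrightarrow> \<psi> s \<in> linear_functionals R M"
    and eq: "\<And>y. y \<in> carrier M \<Longrightarrow> (\<Oplus>\<^bsub>M\<^esub>s\<in>S. \<psi> s y \<odot>\<^bsub>M\<^esub> s) = y"
    by (auto simp: dual_basis_def)
  note D = linear_functionalsD[OF S(3)]
  show "finitely_generated_module R M"
    unfolding finitely_generated_module_def
  proof (intro exI[of _ S] conjI S equalityI subsetI)
    fix y assume y: "y \<in> carrier M"
    show "y \<in> {\<Oplus>\<^bsub>M\<^esub>s\<in>S. c s \<odot>\<^bsub>M\<^esub> s |c. c \<in> S \<rightarrow> carrier R}"
      by (rule CollectI, rule exI[of _ "\<lambda>s. \<psi> s y"]) (use eq[OF y] D y in auto)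
  qed (use S in \<open>auto intro!: M.finsum_closed\<close>)
  let ?F = "free_left_module R S"
  \<comment> \<open>Off \<open>S\<close> the value has to be zero for membership in the free module,
    while \<open>\<psi>\<close> is unconstrained there.\<close>
  define s where "s y = (\<lambda>i. if i \<in> S then \<psi> i y else \<zero>\<^bsub>R\<^esub>)" for y
  define p where "p f = (\<Oplus>\<^bsub>M\<^esub>i\<in>S. f i \<odot>\<^bsub>M\<^esub> i)" for f
  have "s \<in> left_module_hom R M ?F"
    by (rule left_module_homI)
      (use S D in \<open>auto simp: free_left_module_def s_def fun_eq_iff intro!: finite_subset[OF _ S(1)] split: if_splits\<close>)
  moreover have "p \<in> left_module_hom R ?F M"
  proof (rule left_module_homI)
    fix f assume "f \<in> carrier ?F"
    then show "p f \<in> carrier M"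
      unfolding p_def using S by (auto simp: free_left_module_def intro!: M.finsum_closed)
  next
    fix f g assume fg: "f \<in> carrier ?F" "g \<in> carrier ?F"
    then have c: "f i \<in> carrier R" "g i \<in> carrier R" "i \<in> carrier M" if "i \<in> S" for i
      using S that by (auto simp: free_left_module_def)
    have "p (f \<oplus>\<^bsub>?F\<^esub> g) = (\<Oplus>\<^bsub>M\<^esub>i\<in>S. f i \<odot>\<^bsub>M\<^esub> i \<oplus>\<^bsub>M\<^esub> g i \<odot>\<^bsub>M\<^esub> i)"
      unfolding p_def by (rule M.finsum_cong') (use c in \<open>auto simp: free_left_module_def smult_l_distr\<close>)
    also have "\<dots> = p f \<oplus>\<^bsub>M\<^esub> p g"
      unfolding p_def by (rule M.finsum_addf) (use c in auto)
    finally show "p (f \<oplus>\<^bsub>?F\<^esub> g) = p f \<oplus>\<^bsub>M\<^esub> p g" .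
  next
    fix r f assume rf: "r \<in> carrier R" "f \<in> carrier ?F"
    then have c: "f i \<in> carrier R" "i \<in> carrier M" if "i \<in> S" for i
      using S that by (auto simp: free_left_module_def)
    have "p (r \<odot>\<^bsub>?F\<^esub> f) = (\<Oplus>\<^bsub>M\<^esub>i\<in>S. r \<odot>\<^bsub>M\<^esub> (f i \<odot>\<^bsub>M\<^esub> i))"
      unfolding p_def by (rule M.finsum_cong') (use c rf in \<open>auto simp: free_left_module_def smult_assoc1\<close>)
    also have "\<dots> = r \<odot>\<^bsub>M\<^esub> p f"
      unfolding p_def by (rule finsum_smult_right[symmetric]) (use c rf S in auto)
    finally show "p (r \<odot>\<^bsub>?F\<^esub> f) = r \<odot>\<^bsub>M\<^esub> p f" .
  qed
  moreover have "p (s y) = y" if y: "y \<in> carrier M" for y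
  proof -
    have "p (s y) = (\<Oplus>\<^bsub>M\<^esub>i\<in>S. \<psi> i y \<odot>\<^bsub>M\<^esub> i)"
      unfolding p_def by (rule M.finsum_cong') (use S D y in \<open>auto simp: s_def\<close>)
    then show ?thesis using eq[OF y] by simp
  qed
  ultimately show "projective_module R M"
    unfolding projective_module_def using M by blast
qed

section \<open>Free modules and the dual basis criterion\<close>

lemma left_module_free: "ring R \<Longrightarrow> left_module R (free_left_module R I)"
proof -
  assume R: "ring R"
  interpret ring R by fact
  have fin: "finite {i. f i \<oplus>\<^bsub>R\<^esub> g i \<noteq> \<zero>\<^bsub>R\<^esub>}" if "finite {i. f i \<noteq> \<zero>\<^bsub>R\<^esub>}" "finite {i. g i \<noteq> \<zero>\<^bsub>R\<^esub>}" for f g :: "_ \<Rightarrow> 'a"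
    by (rule finite_subset[of _ "{i. f i \<noteq> \<zero>\<^bsub>R\<^esub>} \<union> {i. g i \<noteq> \<zero>\<^bsub>R\<^esub>}"]) (use that in auto)
  have fin2: "finite {i. r \<otimes>\<^bsub>R\<^esub> f i \<noteq> \<zero>\<^bsub>R\<^esub>}" if "finite {i. f i \<noteq> \<zero>\<^bsub>R\<^esub>}" "r \<in> carrier R" for r and f :: "_ \<Rightarrow> 'a"
    by (rule finite_subset[OF _ that(1)]) (use that in auto)
  have cl: "f i \<in> carrier R" if "f \<in> carrier (free_left_module R I)" for f i
    using that by (cases "i \<in> I") (auto simp: free_left_module_def)
  show ?thesis
  proof (intro left_module.intro left_module_axioms.intro R abelian_groupI, goal_cases)
    case (6 f)
    have "{i. \<ominus>\<^bsub>R\<^esub> f i \<noteq> \<zero>\<^bsub>R\<^esub>} \<subseteq> {i. f i \<noteq> \<zero>\<^bsub>R\<^esub>}" by auto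
    then have "finite {i. \<ominus>\<^bsub>R\<^esub> f i \<noteq> \<zero>\<^bsub>R\<^esub>}"
      using 6 by (auto simp: free_left_module_def intro: finite_subset)
    then show ?case using 6 cl[OF 6]
      by (intro bexI[of _ "\<lambda>i. \<ominus>\<^bsub>R\<^esub> f i"]) (auto simp: free_left_module_def l_neg)
  next
    case 3 with cl[OF 3(1)] cl[OF 3(2)] cl[OF 3(3)] show ?case by (simp add: free_left_module_def a_assoc)
  next
    case 4 with cl[OF 4(1)] cl[OF 4(2)] show ?case by (simp add: free_left_module_def a_comm)
  next
    case 5 with cl[OF 5(1)] show ?case by (simp add: free_left_module_def)
  next
    case 8 with cl[OF 8(3)] show ?case by (simp add: free_left_module_def l_distr)
  next
    case 9 with cl[OF 9(2)] cl[OF 9(3)] show ?case by (simp add: free_left_module_def r_distr)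
  next
    case 10 with cl[OF 10(3)] show ?case by (simp add: free_left_module_def m_assoc)
  next
    case 11 with cl[OF 11] show ?case by (simp add: free_left_module_def)
  qed (auto simp: free_left_module_def fin fin2)
qed

text \<open>\<open>I\<close> may be infinite, so the sum runs over a finite \<open>J\<close> outside
  which \<open>f\<close> vanishes. Peeling off the coordinate \<open>j\<close> leaves
  \<open>f\<close> with that coordinate set to zero, which is why the induction varies
  \<open>f\<close>.\<close>

lemma free_left_module_hom_expand:
  assumes M: "left_module R M" and p: "p \<in> left_module_hom R (free_left_module R I) M"
    and J: "finite J" "J \<subseteq> I"
    and f: "f \<in> carrier (free_left_module R I)" "\<And>i. i \<notin> J \<Longrightarrow> f i = \<zero>\<^bsub>R\<^esub>"
  shows "p f = (\<Oplus>\<^bsub>M\<^esub>j\<in>J. f j \<odot>\<^bsub>M\<^esub> p (\<lambda>i. if i = j then \<one>\<^bsub>R\<^esub> else \<zero>\<^bsub>R\<^esub>))"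
  using J f
proof (induction J arbitrary: f rule: finite_induct)
  interpret left_module R M by fact
  let ?F = "free_left_module R I"
  {
    case empty
    then have "f = \<zero>\<^bsub>?F\<^esub>" by (auto simp: free_left_module_def)
    then show ?case using left_module_hom_zero[OF left_module_free M p] R.ring_axioms by simp
  next
    case (insert j J)
    let ?e = "\<lambda>j i. if i = j then \<one>\<^bsub>R\<^esub> else \<zero>\<^bsub>R\<^esub>"
    let ?g = "f(j := \<zero>\<^bsub>R\<^esub>)"
    have j: "j \<in> I" and JI: "J \<subseteq> I" and fj: "f j \<in> carrier R" using insert.prems by (auto simp: free_left_module_def)
    have e: "?e i \<in> carrier ?F" if "i \<in> I" for i
      using that by (auto simp: free_left_module_def)
    have g: "?g \<in> carrier ?F"
      using insert.prems j by (auto simp: free_left_module_def intro: rev_finite_subset)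
    have fe: "f j \<odot>\<^bsub>?F\<^esub> ?e j \<in> carrier ?F"
      using left_module.smult_closed[OF left_module_free[OF R.ring_axioms] fj e[OF j]] .
    have c: "f i \<in> carrier R" for i
      using insert.prems by (cases "i \<in> I") (auto simp: free_left_module_def)
    have "f = f j \<odot>\<^bsub>?F\<^esub> ?e j \<oplus>\<^bsub>?F\<^esub> ?g"
      by (rule ext) (use c in \<open>auto simp: free_left_module_def\<close>)
    then have "p f = f j \<odot>\<^bsub>M\<^esub> p (?e j) \<oplus>\<^bsub>M\<^esub> p ?g"
      using left_module_homD(2)[OF p fe g] left_module_homD(3)[OF p fj e[OF j]] by simp
    also have "p ?g = (\<Oplus>\<^bsub>M\<^esub>i\<in>J. ?g i \<odot>\<^bsub>M\<^esub> p (?e i))"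
      by (rule insert.IH) (use insert.prems g JI in \<open>auto simp: fun_upd_def\<close>)
    also have "\<dots> = (\<Oplus>\<^bsub>M\<^esub>i\<in>J. f i \<odot>\<^bsub>M\<^esub> p (?e i))"
      by (rule M.finsum_cong') (use insert.hyps c JI e left_module_homD(1)[OF p] in auto)
    also have "f j \<odot>\<^bsub>M\<^esub> p (?e j) \<oplus>\<^bsub>M\<^esub> \<dots> = (\<Oplus>\<^bsub>M\<^esub>i\<in>insert j J. f i \<odot>\<^bsub>M\<^esub> p (?e i))"
      by (rule M.finsum_insert[symmetric])
        (use insert.hyps j JI c e left_module_homD(1)[OF p] in auto)
    finally show ?case .
  }
qed

text \<open>For the direction from the two separate properties, the coordinates of the section
  \<open>s\<close> serve as functionals and the images under \<open>p\<close> of the unit vectors as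
  elements; finite generation cuts the possibly infinite index set down to a finite one.\<close>

lemma fgp_module_iff:
  fixes M :: "('r, 'm, 'y) module_scheme"
  shows "fgp_module R M \<longleftrightarrow> projective_module R M \<and> finitely_generated_module R M"
proof (intro iffI conjI fgp_module_imp)
  assume "projective_module R M \<and> finitely_generated_module R M"
  then obtain I :: "'m set" and s p S where M: "left_module R M"
    and s: "s \<in> left_module_hom R M (free_left_module R I)"
    and p: "p \<in> left_module_hom R (free_left_module R I) M"
    and ps: "\<And>x. x \<in> carrier M \<Longrightarrow> p (s x) = x"
    and S: "finite S" "S \<subseteq> carrier M"
    and gen: "carrier M = {\<Oplus>\<^bsub>M\<^esub>s\<in>S. c s \<odot>\<^bsub>M\<^esub> s | c. c \<in> S \<rightarrow> carrier R}"
    unfolding projective_module_def finitely_generated_module_def by blast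
  interpret left_module R M by fact
  let ?F = "free_left_module R I"
  interpret F: left_module R ?F by (rule left_module_free) (rule R.ring_axioms)
  \<comment> \<open>All coordinates that occur in the images of the generators: finitely many, since
    every element of the free module has finite support.\<close>
  define J where "J = (\<Union>x\<in>S. {i. s x i \<noteq> \<zero>\<^bsub>R\<^esub>})"
  note sD = left_module_homD[OF s] and pD = left_module_homD[OF p]
  have J: "finite J" "J \<subseteq> I"
    using S sD(1) by (auto simp: J_def free_left_module_def)
  \<comment> \<open>The \<open>i\<close>-th coordinate of \<open>s\<close> is linear and vanishes on
    every generator, hence on all of \<open>M\<close>.\<close>
  have supp: "s y i = \<zero>\<^bsub>R\<^esub>" if i: "i \<notin> J" and y: "y \<in> carrier M" for y i
  proof -
    obtain c where c: "c \<in> S \<rightarrow> carrier R" "y = (\<Oplus>\<^bsub>M\<^esub>x\<in>S. c x \<odot>\<^bsub>M\<^esub> x)" using gen y by auto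
    have cl: "s x i \<in> carrier R" if "x \<in> carrier M" for x
      using sD(1)[OF that] by (cases "i \<in> I") (auto simp: free_left_module_def)
    have "s y i = (\<Oplus>\<^bsub>R\<^esub>x\<in>S. s (c x \<odot>\<^bsub>M\<^esub> x) i)"
      unfolding c(2)
      by (rule additive_hom_finsum[OF M.abelian_group_axioms R.abelian_group_axioms, where h = "\<lambda>x. s x i"])
        (use S c cl sD in \<open>auto simp: free_left_module_def\<close>)
    also have "\<dots> = (\<Oplus>\<^bsub>R\<^esub>x\<in>S. \<zero>\<^bsub>R\<^esub>)"
      by (rule R.finsum_cong') (use S c sD i in \<open>auto simp: free_left_module_def J_def Pi_def subset_eq\<close>)
    finally show ?thesis by simp
  qed
  let ?e = "\<lambda>j i. if i = j then \<one>\<^bsub>R\<^esub> else \<zero>\<^bsub>R\<^esub>"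
  have "dual_basis R M J (\<lambda>j. p (?e j)) (\<lambda>j y. s y j)"
    unfolding dual_basis_def
  proof (intro conjI ballI J)
    have "?e j \<in> carrier ?F" if "j \<in> J" for j using that J by (auto simp: free_left_module_def)
    then show "(\<lambda>j. p (?e j)) \<in> J \<rightarrow> carrier M" using pD by auto
    show "(\<lambda>j y. s y j) \<in> J \<rightarrow> linear_functionals R M"
      using J sD by (auto simp: free_left_module_def intro!: linear_functionalsI)
    fix y assume y: "y \<in> carrier M"
    show "(\<Oplus>\<^bsub>M\<^esub>j\<in>J. s y j \<odot>\<^bsub>M\<^esub> p (?e j)) = y"
      using free_left_module_hom_expand[OF M p J sD(1)[OF y]] supp[OF _ y] ps[OF y] by simp
  qed
  then show "fgp_module R M" by (rule fgp_moduleI[OF M])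
qed

section \<open>Finite projective resolutions over arbitrary element types\<close>

text \<open>The data of \<open>perfect_module\<close>, with kernels as plain sets and an element
  type \<open>'p\<close> independent of the ring. This freedom lets corners, restrictions and direct
  sums of resolutions count as resolutions.\<close>

definition fgp_resolution ::
    "('r, 'x) ring_scheme \<Rightarrow> ('r, 'm, 'y) module_scheme \<Rightarrow> (nat \<Rightarrow> ('r, 'p) module)
      \<Rightarrow> (nat \<Rightarrow> 'p \<Rightarrow> 'p) \<Rightarrow> ('p \<Rightarrow> 'm) \<Rightarrow> nat \<Rightarrow> bool"
  where "fgp_resolution R M P d e n \<longleftrightarrow>
    (\<forall>i. fgp_module R (P i)) \<and>
    (\<forall>i. d i \<in> left_module_hom R (P (Suc i)) (P i)) \<and>
    e \<in> left_module_hom R (P 0) M \<and>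
    e ` carrier (P 0) = carrier M \<and>
    d 0 ` carrier (P 1) = {x \<in> carrier (P 0). e x = \<zero>\<^bsub>M\<^esub>} \<and>
    (\<forall>i. d (Suc i) ` carrier (P (Suc (Suc i))) = {x \<in> carrier (P (Suc i)). d i x = \<zero>\<^bsub>P i\<^esub>}) \<and>
    (\<forall>i>n. carrier (P i) = {\<zero>\<^bsub>P i\<^esub>})"

lemma perfect_module_iff_resolution:
  fixes M :: "('r, 'm, 'y) module_scheme"
  shows "perfect_module R M \<longleftrightarrow>
    (\<exists>(P :: nat \<Rightarrow> ('r, nat \<Rightarrow> 'r) module) d e n. fgp_resolution R M P d e n)"
  by (simp add: perfect_module_def fgp_resolution_def fgp_module_iff a_kernel_def' del: One_nat_def)

section \<open>Transport of structure along an injection\<close>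

definition transport_module ::
    "('m \<Rightarrow> 'n) \<Rightarrow> ('r, 'm, 'y) module_scheme \<Rightarrow> ('r, 'n) module"
  where "transport_module j M =
    \<lparr>carrier = j ` carrier M, monoid.mult = undefined, one = undefined,
     ring.zero = j \<zero>\<^bsub>M\<^esub>,
     ring.add = (\<lambda>x y. j (inv_into (carrier M) j x \<oplus>\<^bsub>M\<^esub> inv_into (carrier M) j y)),
     smult = (\<lambda>r x. j (r \<odot>\<^bsub>M\<^esub> inv_into (carrier M) j x))\<rparr>"

context
  fixes R :: "('r, 'x) ring_scheme" and M :: "('r, 'm, 'y) module_scheme" and j :: "'m \<Rightarrow> 'n"
  assumes M: "left_module R M" and j: "inj_on j (carrier M)"
begin

interpretation left_module R M by (rule M)

lemma transport_simps:
  "carrier (transport_module j M) = j ` carrier M" "\<zero>\<^bsub>transport_module j M\<^esub> = j \<zero>\<^bsub>M\<^esub>"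
  "\<lbrakk>x \<in> carrier M; y \<in> carrier M\<rbrakk> \<Longrightarrow> j x \<oplus>\<^bsub>transport_module j M\<^esub> j y = j (x \<oplus>\<^bsub>M\<^esub> y)"
  "x \<in> carrier M \<Longrightarrow> r \<odot>\<^bsub>transport_module j M\<^esub> j x = j (r \<odot>\<^bsub>M\<^esub> x)"
  by (simp_all add: transport_module_def inv_into_f_f[OF j])

lemma left_module_transport: "left_module R (transport_module j M)"
proof (intro left_module.intro left_module_axioms.intro R.ring_axioms abelian_groupI, goal_cases)
  case (6 x)
  then obtain y where "y \<in> carrier M" "x = j y" by (auto simp: transport_simps)
  then show ?case by (intro bexI[of _ "j (\<ominus>\<^bsub>M\<^esub> y)"]) (auto simp: transport_simps M.l_neg)
qed (auto simp: transport_simps M.a_ac smult_l_distr smult_r_distr smult_assoc1)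

lemma transport_hom: "j \<in> left_module_hom R M (transport_module j M)"
  by (rule left_module_homI) (auto simp: transport_simps)

lemma transport_inv_hom: "inv_into (carrier M) j \<in> left_module_hom R (transport_module j M) M"
  by (rule left_module_homI) (auto simp: transport_simps inv_into_f_f[OF j])

text \<open>A dual basis moves along the bijection onto the image: elements by \<open>j\<close>,
  functionals by precomposition with the inverse of \<open>j\<close> on the carrier.\<close>

lemma fgp_module_transport:
  assumes "fgp_module R M"
  shows "fgp_module R (transport_module j M)"
proof -
  from assms obtain n :: nat and x \<phi> where db: "dual_basis R M {..<n} x \<phi>"
    by (auto simp: fgp_module_def)
  then have x: "x \<in> {..<n} \<rightarrow> carrier M" "\<And>i. i < n \<Longrightarrow> \<phi> i \<in> linear_functionals R M"
    and eq: "\<And>y. y \<in> carrier M \<Longrightarrow> (\<Oplus>\<^bsub>M\<^esub>i\<in>{..<n}. \<phi> i y \<odot>\<^bsub>M\<^esub> x i) = y"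
    by (auto simp: dual_basis_def)
  note D = linear_functionalsD[OF x(2)]
  interpret T: left_module R "transport_module j M" by (rule left_module_transport)
  show ?thesis
  proof (rule fgp_moduleI[OF left_module_transport])
    show "dual_basis R (transport_module j M) {..<n} (\<lambda>i. j (x i)) (\<lambda>i y. \<phi> i (inv_into (carrier M) j y))"
      unfolding dual_basis_def
    proof (intro conjI ballI)
      show "(\<lambda>i y. \<phi> i (inv_into (carrier M) j y)) \<in> {..<n} \<rightarrow> linear_functionals R (transport_module j M)"
        using D by (auto intro!: linear_functionalsI simp: transport_simps inv_into_f_f[OF j])
      fix y assume "y \<in> carrier (transport_module j M)"
      then obtain z where z: "z \<in> carrier M" "y = j z" by (auto simp: transport_simps)
      have "j z = j (\<Oplus>\<^bsub>M\<^esub>i\<in>{..<n}. \<phi> i z \<odot>\<^bsub>M\<^esub> x i)" using eq[OF z(1)] by simp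
      also have "\<dots> = (\<Oplus>\<^bsub>transport_module j M\<^esub>i\<in>{..<n}. j (\<phi> i z \<odot>\<^bsub>M\<^esub> x i))"
        by (rule additive_hom_finsum[OF M.abelian_group_axioms T.M.abelian_group_axioms])
          (use x D z transport_simps in auto)
      also have "\<dots> = (\<Oplus>\<^bsub>transport_module j M\<^esub>i\<in>{..<n}. \<phi> i z \<odot>\<^bsub>transport_module j M\<^esub> j (x i))"
        by (rule T.M.finsum_cong') (use x D z transport_simps in \<open>auto simp: Pi_def\<close>)
      finally show "(\<Oplus>\<^bsub>transport_module j M\<^esub>i\<in>{..<n}.
          \<phi> i (inv_into (carrier M) j y) \<odot>\<^bsub>transport_module j M\<^esub> j (x i)) = y"
        unfolding z(2) inv_into_f_f[OF j z(1)] by (rule sym)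
    qed (use x in \<open>auto simp: transport_simps\<close>)
  qed
qed

end

text \<open>The coefficients with respect to a dual basis determine the element. An injection of
  sets suffices, since \<open>transport_module\<close> carries the module structure over
  afterwards.\<close>

lemma fgp_module_embeds:
  fixes M :: "('r, 'm, 'y) module_scheme"
  assumes "fgp_module R M"
  shows "\<exists>j :: 'm \<Rightarrow> nat \<Rightarrow> 'r. inj_on j (carrier M)"
proof -
  from assms obtain n :: nat and x \<phi> where db: "dual_basis R M {..<n} x \<phi>" and M: "left_module R M"
    by (auto simp: fgp_module_def)
  interpret left_module R M by (rule M)
  from db have x: "x \<in> {..<n} \<rightarrow> carrier M" "\<And>i. i < n \<Longrightarrow> \<phi> i \<in> linear_functionals R M"
    and eq: "\<And>y. y \<in> carrier M \<Longrightarrow> (\<Oplus>\<^bsub>M\<^esub>i\<in>{..<n}. \<phi> i y \<odot>\<^bsub>M\<^esub> x i) = y"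
    by (auto simp: dual_basis_def)
  note D = linear_functionalsD[OF x(2)]
  \<comment> \<open>The coordinates \<open>i \<ge> n\<close> take arbitrary values and are left as
    they are: agreement on the first \<open>n\<close> already forces \<open>y = z\<close>.\<close>
  have "inj_on (\<lambda>y i. \<phi> i y) (carrier M)"
  proof (rule inj_onI)
    fix y z assume y: "y \<in> carrier M" and z: "z \<in> carrier M" and e: "(\<lambda>i. \<phi> i y) = (\<lambda>i. \<phi> i z)"
    have "(\<Oplus>\<^bsub>M\<^esub>i\<in>{..<n}. \<phi> i y \<odot>\<^bsub>M\<^esub> x i) = (\<Oplus>\<^bsub>M\<^esub>i\<in>{..<n}. \<phi> i z \<odot>\<^bsub>M\<^esub> x i)"
      by (simp only: fun_cong[OF e])
    then show "y = z" unfolding eq[OF y] eq[OF z] .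
  qed
  then show ?thesis by blast
qed

lemma left_module_hom_comp:
  assumes "f \<in> left_module_hom R M N" "g \<in> left_module_hom R L M"
  shows "(\<lambda>x. f (g x)) \<in> left_module_hom R L N"
  using left_module_homD[OF assms(1)] left_module_homD[OF assms(2)] by (auto intro!: left_module_homI)

text \<open>Returns from an arbitrary element type to the prescribed one: each term is replaced by
  its image under an injection into \<open>nat \<Rightarrow> 'r\<close>, and exactness survives
  because the maps are only composed with bijections.\<close>

lemma perfect_moduleI:
  fixes P :: "nat \<Rightarrow> ('r, 'p) module" and M :: "('r, 'm, 'y) module_scheme"
  assumes "fgp_resolution R M P d e n"
  shows "perfect_module R M"
proof -
  from assms have fgp: "\<And>i. fgp_module R (P i)"
    and d: "\<And>i. d i \<in> left_module_hom R (P (Suc i)) (P i)" and e: "e \<in> left_module_hom R (P 0) M"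
    and e_img: "e ` carrier (P 0) = carrier M"
    and d0: "d 0 ` carrier (P (Suc 0)) = {x \<in> carrier (P 0). e x = \<zero>\<^bsub>M\<^esub>}"
    and dS: "\<And>i. d (Suc i) ` carrier (P (Suc (Suc i))) = {x \<in> carrier (P (Suc i)). d i x = \<zero>\<^bsub>P i\<^esub>}"
    and fin: "\<And>i. i > n \<Longrightarrow> carrier (P i) = {\<zero>\<^bsub>P i\<^esub>}"
    by (simp_all add: fgp_resolution_def)
  have lm: "left_module R (P i)" for i using fgp by (simp add: fgp_module_def)
  interpret P: left_module R "P i" for i by (rule lm)
  obtain j :: "nat \<Rightarrow> 'p \<Rightarrow> nat \<Rightarrow> 'r" where j: "\<And>i. inj_on (j i) (carrier (P i))"
    using fgp_module_embeds[OF fgp] by metis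
  define g where "g i = inv_into (carrier (P i)) (j i)" for i
  define Q where "Q i = transport_module (j i) (P i)" for i
  have gj: "g i (j i x) = x" if "x \<in> carrier (P i)" for i x
    unfolding g_def by (rule inv_into_f_f[OF j that])
  have Q: "carrier (Q i) = j i ` carrier (P i)" "\<zero>\<^bsub>Q i\<^esub> = j i \<zero>\<^bsub>P i\<^esub>" for i
    by (simp_all add: Q_def transport_simps[OF lm j])
  have gQ: "g i ` carrier (Q i) = carrier (P i)" for i
    unfolding Q using gj by (force simp: image_iff)
  have jh: "j i \<in> left_module_hom R (P i) (Q i)" for i
    unfolding Q_def by (rule transport_hom[OF lm j])
  have gh: "g i \<in> left_module_hom R (Q i) (P i)" for i
    unfolding Q_def g_def by (rule transport_inv_hom[OF lm j])
  have dc: "d i x \<in> carrier (P i)" if "x \<in> carrier (P (Suc i))" for i x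
    using left_module_homD(1)[OF d that] .
  \<comment> \<open>\<open>d i\<close> starts in degree \<open>Suc i\<close>, so elements are read
    back by \<open>g (Suc i)\<close> and pushed forward by \<open>j i\<close>; the target
    \<open>M\<close> of the augmentation stays in place.\<close>
  have "fgp_resolution R M Q (\<lambda>i x. j i (d i (g (Suc i) x))) (\<lambda>x. e (g 0 x)) n"
    unfolding fgp_resolution_def
  proof (intro conjI allI impI)
    fix i
    show "fgp_module R (Q i)" unfolding Q_def by (rule fgp_module_transport[OF lm j fgp])
    show "(\<lambda>x. j i (d i (g (Suc i) x))) \<in> left_module_hom R (Q (Suc i)) (Q i)"
      by (intro left_module_hom_comp[OF jh] left_module_hom_comp[OF d] gh)
    have "(\<lambda>x. j (Suc i) (d (Suc i) (g (Suc (Suc i)) x))) ` carrier (Q (Suc (Suc i)))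
        = j (Suc i) ` d (Suc i) ` g (Suc (Suc i)) ` carrier (Q (Suc (Suc i)))"
      by (simp add: image_image)
    also have "\<dots> = j (Suc i) ` {x \<in> carrier (P (Suc i)). d i x = \<zero>\<^bsub>P i\<^esub>}"
      unfolding gQ dS ..
    also have "\<dots> = {x \<in> carrier (Q (Suc i)). j i (d i (g (Suc i) x)) = \<zero>\<^bsub>Q i\<^esub>}"
      using gj dc by (auto simp: Q inj_on_eq_iff[OF j])
    finally show "(\<lambda>x. j (Suc i) (d (Suc i) (g (Suc (Suc i)) x))) ` carrier (Q (Suc (Suc i))) =
        {x \<in> carrier (Q (Suc i)). j i (d i (g (Suc i) x)) = \<zero>\<^bsub>Q i\<^esub>}" .
  next
    show "(\<lambda>x. e (g 0 x)) \<in> left_module_hom R (Q 0) M" by (rule left_module_hom_comp[OF e gh])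
    have "(\<lambda>x. e (g 0 x)) ` carrier (Q 0) = e ` g 0 ` carrier (Q 0)" by (simp add: image_image)
    then show "(\<lambda>x. e (g 0 x)) ` carrier (Q 0) = carrier M" by (simp only: gQ e_img)
    have "(\<lambda>x. j 0 (d 0 (g (Suc 0) x))) ` carrier (Q 1) = j 0 ` d 0 ` g (Suc 0) ` carrier (Q (Suc 0))"
      by (simp add: image_image)
    also have "\<dots> = {x \<in> carrier (Q 0). e (g 0 x) = \<zero>\<^bsub>M\<^esub>}"
      unfolding gQ d0 using gj by (auto simp: Q)
    finally show "(\<lambda>x. j 0 (d 0 (g (Suc 0) x))) ` carrier (Q 1) = {x \<in> carrier (Q 0). e (g 0 x) = \<zero>\<^bsub>M\<^esub>}" .
  qed (simp add: Q fin)
  then show ?thesis unfolding perfect_module_iff_resolution by blast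
qed

section \<open>Direct sums and isomorphisms of perfect modules\<close>

definition direct_sum_module ::
    "('r, 'm, 'y) module_scheme \<Rightarrow> ('r, 'n, 'z) module_scheme \<Rightarrow> ('r, 'm \<times> 'n) module"
  where "direct_sum_module M N =
    \<lparr>carrier = carrier M \<times> carrier N, monoid.mult = undefined, one = undefined,
     ring.zero = (\<zero>\<^bsub>M\<^esub>, \<zero>\<^bsub>N\<^esub>),
     ring.add = (\<lambda>(x, y) (x', y'). (x \<oplus>\<^bsub>M\<^esub> x', y \<oplus>\<^bsub>N\<^esub> y')),
     smult = (\<lambda>r (x, y). (r \<odot>\<^bsub>M\<^esub> x, r \<odot>\<^bsub>N\<^esub> y))\<rparr>"

lemma direct_sum_module_simps [simp]:
  "carrier (direct_sum_module M N) = carrier M \<times> carrier N"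
  "\<zero>\<^bsub>direct_sum_module M N\<^esub> = (\<zero>\<^bsub>M\<^esub>, \<zero>\<^bsub>N\<^esub>)"
  "(x, y) \<oplus>\<^bsub>direct_sum_module M N\<^esub> (x', y') = (x \<oplus>\<^bsub>M\<^esub> x', y \<oplus>\<^bsub>N\<^esub> y')"
  "r \<odot>\<^bsub>direct_sum_module M N\<^esub> (x, y) = (r \<odot>\<^bsub>M\<^esub> x, r \<odot>\<^bsub>N\<^esub> y)"
  by (simp_all add: direct_sum_module_def)

lemma left_module_direct_sum:
  assumes "left_module R M" "left_module R N"
  shows "left_module R (direct_sum_module M N)"
proof -
  interpret M: left_module R M by fact
  interpret N: left_module R N by fact
  show ?thesis
  proof (intro left_module.intro left_module_axioms.intro M.R.ring_axioms abelian_groupI, goal_cases)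
    case (6 x)
    then show ?case
      by (intro bexI[of _ "(\<ominus>\<^bsub>M\<^esub> fst x, \<ominus>\<^bsub>N\<^esub> snd x)"]) (auto simp: M.M.l_neg N.M.l_neg)
  qed (auto simp: M.M.a_ac N.M.a_ac M.smult_l_distr M.smult_r_distr M.smult_assoc1
      N.smult_l_distr N.smult_r_distr N.smult_assoc1)
qed

text \<open>The disjoint union of two dual bases, each element padded by zero in the other summand
  and each functional reading its own component.\<close>

lemma fgp_module_direct_sum:
  assumes "fgp_module R M" "fgp_module R N"
  shows "fgp_module R (direct_sum_module M N)"
proof -
  let ?D = "direct_sum_module M N"
  from assms obtain m x \<phi> n y \<psi>
    where dbM: "dual_basis R M {..<m::nat} x \<phi>" and dbN: "dual_basis R N {..<n::nat} y \<psi>"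
    by (auto simp: fgp_module_def)
  from assms have lm: "left_module R M" "left_module R N" by (auto simp: fgp_module_def)
  interpret M: left_module R M by fact
  interpret N: left_module R N by fact
  interpret D: left_module R ?D by (rule left_module_direct_sum[OF lm])
  from dbM have x: "\<And>i. i < m \<Longrightarrow> x i \<in> carrier M" "\<And>i. i < m \<Longrightarrow> \<phi> i \<in> linear_functionals R M"
    and eqM: "\<And>z. z \<in> carrier M \<Longrightarrow> (\<Oplus>\<^bsub>M\<^esub>i\<in>{..<m}. \<phi> i z \<odot>\<^bsub>M\<^esub> x i) = z"
    by (auto simp: dual_basis_def)
  from dbN have y: "\<And>i. i < n \<Longrightarrow> y i \<in> carrier N" "\<And>i. i < n \<Longrightarrow> \<psi> i \<in> linear_functionals R N"
    and eqN: "\<And>z. z \<in> carrier N \<Longrightarrow> (\<Oplus>\<^bsub>N\<^esub>i\<in>{..<n}. \<psi> i z \<odot>\<^bsub>N\<^esub> y i) = z"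
    by (auto simp: dual_basis_def)
  note DM = linear_functionalsD[OF x(2)] and DN = linear_functionalsD[OF y(2)]
  let ?I = "Inl ` {..<m} \<union> Inr ` {..<n}"
  let ?x = "case_sum (\<lambda>i. (x i, \<zero>\<^bsub>N\<^esub>)) (\<lambda>i. (\<zero>\<^bsub>M\<^esub>, y i))"
  let ?\<phi> = "case_sum (\<lambda>i (a, b). \<phi> i a) (\<lambda>i (a, b). \<psi> i b)"
  show ?thesis
  proof (rule fgp_moduleI[OF left_module_direct_sum[OF lm]])
    show "dual_basis R ?D ?I ?x ?\<phi>"
      unfolding dual_basis_def
    proof (intro conjI ballI)
      show "?x \<in> ?I \<rightarrow> carrier ?D" using x y by auto
      show "?\<phi> \<in> ?I \<rightarrow> linear_functionals R ?D"
        using DM DN by (auto intro!: linear_functionalsI)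
      fix z assume "z \<in> carrier ?D"
      then obtain a b where z: "z = (a, b)" "a \<in> carrier M" "b \<in> carrier N" by auto
      have "(\<Oplus>\<^bsub>?D\<^esub>i\<in>?I. ?\<phi> i z \<odot>\<^bsub>?D\<^esub> ?x i) =
          (\<Oplus>\<^bsub>?D\<^esub>i\<in>Inl ` {..<m}. ?\<phi> i z \<odot>\<^bsub>?D\<^esub> ?x i) \<oplus>\<^bsub>?D\<^esub> (\<Oplus>\<^bsub>?D\<^esub>i\<in>Inr ` {..<n}. ?\<phi> i z \<odot>\<^bsub>?D\<^esub> ?x i)"
        by (rule D.M.finsum_Un_disjoint) (use x y z DM DN in auto)
      also have "(\<Oplus>\<^bsub>?D\<^esub>i\<in>Inl ` {..<m}. ?\<phi> i z \<odot>\<^bsub>?D\<^esub> ?x i) =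
          (\<Oplus>\<^bsub>?D\<^esub>i\<in>{..<m}. ?\<phi> (Inl i) z \<odot>\<^bsub>?D\<^esub> ?x (Inl i))"
        by (rule D.M.add.finprod_reindex) (use x z DM in auto)
      also have "\<dots> = (\<Oplus>\<^bsub>?D\<^esub>i\<in>{..<m}. (\<phi> i a \<odot>\<^bsub>M\<^esub> x i, \<zero>\<^bsub>N\<^esub>))"
        by (rule D.M.finsum_cong') (use x z DM in auto)
      also have "\<dots> = (\<Oplus>\<^bsub>M\<^esub>i\<in>{..<m}. \<phi> i a \<odot>\<^bsub>M\<^esub> x i, \<zero>\<^bsub>N\<^esub>)"
        by (rule additive_hom_finsum[OF M.M.abelian_group_axioms D.M.abelian_group_axioms,
              where h = "\<lambda>u. (u, \<zero>\<^bsub>N\<^esub>)", symmetric]) (use x z DM in auto)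
      also have "\<dots> = (a, \<zero>\<^bsub>N\<^esub>)" using eqM z by simp
      also have "(\<Oplus>\<^bsub>?D\<^esub>i\<in>Inr ` {..<n}. ?\<phi> i z \<odot>\<^bsub>?D\<^esub> ?x i) =
          (\<Oplus>\<^bsub>?D\<^esub>i\<in>{..<n}. ?\<phi> (Inr i) z \<odot>\<^bsub>?D\<^esub> ?x (Inr i))"
        by (rule D.M.add.finprod_reindex) (use y z DN in auto)
      also have "\<dots> = (\<Oplus>\<^bsub>?D\<^esub>i\<in>{..<n}. (\<zero>\<^bsub>M\<^esub>, \<psi> i b \<odot>\<^bsub>N\<^esub> y i))"
        by (rule D.M.finsum_cong') (use y z DN in auto)
      also have "\<dots> = (\<zero>\<^bsub>M\<^esub>, \<Oplus>\<^bsub>N\<^esub>i\<in>{..<n}. \<psi> i b \<odot>\<^bsub>N\<^esub> y i)"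
        by (rule additive_hom_finsum[OF N.M.abelian_group_axioms D.M.abelian_group_axioms,
              where h = "\<lambda>u. (\<zero>\<^bsub>M\<^esub>, u)", symmetric]) (use y z DN in auto)
      also have "\<dots> = (\<zero>\<^bsub>M\<^esub>, b)" using eqN z by simp
      also have "(a, \<zero>\<^bsub>N\<^esub>) \<oplus>\<^bsub>?D\<^esub> (\<zero>\<^bsub>M\<^esub>, b) = z" using z by simp
      finally show "(\<Oplus>\<^bsub>?D\<^esub>i\<in>?I. ?\<phi> i z \<odot>\<^bsub>?D\<^esub> ?x i) = z" .
    qed auto
  qed
qed

lemma map_prod_hom:
  assumes "f \<in> left_module_hom R L K" "g \<in> left_module_hom R L' K'"
  shows "map_prod f g \<in> left_module_hom R (direct_sum_module L L') (direct_sum_module K K')"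
  using left_module_homD[OF assms(1)] left_module_homD[OF assms(2)]
  by (intro left_module_homI) auto

text \<open>Images and kernels of \<open>map_prod\<close> are products, so the termwise sum of two
  resolutions is exact; beyond \<open>max m n\<close> both summands vanish. Its elements are pairs,
  and \<open>perfect_moduleI\<close> brings it back to the required type.\<close>

lemma perfect_module_direct_sum:
  fixes M :: "('r, 'm, 'y) module_scheme" and N :: "('r, 'n, 'z) module_scheme"
  assumes M: "perfect_module R M" and N: "perfect_module R N"
  shows "perfect_module R (direct_sum_module M N)"
proof -
  obtain P :: "nat \<Rightarrow> ('r, nat \<Rightarrow> 'r) module" and d e m where "fgp_resolution R M P d e m"
    using M perfect_module_iff_resolution by fast
  then have P: "\<And>i. fgp_module R (P i)"
    and d: "\<And>i. d i \<in> left_module_hom R (P (Suc i)) (P i)" and e: "e \<in> left_module_hom R (P 0) M"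
    and e_img: "e ` carrier (P 0) = carrier M"
    and d0: "d 0 ` carrier (P (Suc 0)) = {x \<in> carrier (P 0). e x = \<zero>\<^bsub>M\<^esub>}"
    and dS: "\<And>i. d (Suc i) ` carrier (P (Suc (Suc i))) = {x \<in> carrier (P (Suc i)). d i x = \<zero>\<^bsub>P i\<^esub>}"
    and fin: "\<And>i. i > m \<Longrightarrow> carrier (P i) = {\<zero>\<^bsub>P i\<^esub>}"
    by (simp_all add: fgp_resolution_def)
  obtain Q :: "nat \<Rightarrow> ('r, nat \<Rightarrow> 'r) module" and d' e' n where "fgp_resolution R N Q d' e' n"
    using N perfect_module_iff_resolution by fast
  then have Q: "\<And>i. fgp_module R (Q i)"
    and d': "\<And>i. d' i \<in> left_module_hom R (Q (Suc i)) (Q i)" and e': "e' \<in> left_module_hom R (Q 0) N"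
    and e_img': "e' ` carrier (Q 0) = carrier N"
    and d0': "d' 0 ` carrier (Q (Suc 0)) = {x \<in> carrier (Q 0). e' x = \<zero>\<^bsub>N\<^esub>}"
    and dS': "\<And>i. d' (Suc i) ` carrier (Q (Suc (Suc i))) = {x \<in> carrier (Q (Suc i)). d' i x = \<zero>\<^bsub>Q i\<^esub>}"
    and fin': "\<And>i. i > n \<Longrightarrow> carrier (Q i) = {\<zero>\<^bsub>Q i\<^esub>}"
    by (simp_all add: fgp_resolution_def)
  have "fgp_resolution R (direct_sum_module M N) (\<lambda>i. direct_sum_module (P i) (Q i))
      (\<lambda>i. map_prod (d i) (d' i)) (map_prod e e') (max m n)"
    unfolding fgp_resolution_def
    by (intro conjI allI impI fgp_module_direct_sum P Q map_prod_hom d d' e e')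
      (auto simp: map_prod_surj_on[OF refl refl] e_img e_img' d0 d0' dS dS' fin fin')
  then show ?thesis by (rule perfect_moduleI)
qed

text \<open>Only the augmentation changes: injectivity of \<open>h\<close> preserves its kernel and
  surjectivity makes it reach all of \<open>N\<close>.\<close>

lemma perfect_module_iso:
  fixes M :: "('r, 'm, 'y) module_scheme" and N :: "('r, 'n, 'z) module_scheme"
  assumes M: "left_module R M" and N: "left_module R N" and perf: "perfect_module R M"
    and h: "h \<in> left_module_hom R M N" "bij_betw h (carrier M) (carrier N)"
  shows "perfect_module R N"
proof -
  interpret M: left_module R M by fact
  obtain P :: "nat \<Rightarrow> ('r, nat \<Rightarrow> 'r) module" and d e n where "fgp_resolution R M P d e n"
    using perf perfect_module_iff_resolution by fast
  then have e: "e \<in> left_module_hom R (P 0) M" and e_img: "e ` carrier (P 0) = carrier M"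
    and res: "fgp_resolution R M P d e n"
    by (simp_all add: fgp_resolution_def)
  have "h x = \<zero>\<^bsub>N\<^esub> \<longleftrightarrow> x = \<zero>\<^bsub>M\<^esub>" if "x \<in> carrier M" for x
    using h(2) that left_module_hom_zero[OF M N h(1)] M.M.zero_closed
    by (metis bij_betw_def inj_on_eq_iff)
  then have "{x \<in> carrier (P 0). h (e x) = \<zero>\<^bsub>N\<^esub>} = {x \<in> carrier (P 0). e x = \<zero>\<^bsub>M\<^esub>}"
    using left_module_homD(1)[OF e] by auto
  moreover have "(\<lambda>x. h (e x)) ` carrier (P 0) = carrier N"
    using e_img h(2) by (simp add: bij_betw_def image_image[of h e, symmetric])
  ultimately have "fgp_resolution R N P d (\<lambda>x. h (e x)) n"
    using res left_module_hom_comp[OF h(1) e] by (simp add: fgp_resolution_def)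
  then show ?thesis by (rule perfect_moduleI)
qed

section \<open>Perfect modules over a ring and over an idempotent corner\<close>

text \<open>The axioms make \<open>\<iota>\<close> a bijection of \<open>S\<close> onto the ideal of
  \<open>E\<close> generated by the central idempotent \<open>\<iota> \<one>\<close>, with
  \<open>\<pi>\<close> as multiplication by this idempotent followed by the inverse bijection.
  Abstract rings keep the cosets of the tensor product out of the homological argument.\<close>

locale idempotent_corner = E: ring E + S: ring S
  for E :: "('e, 'x) ring_scheme" and S :: "('s, 'y) ring_scheme" +
  fixes \<pi> :: "'e \<Rightarrow> 's" and \<iota> :: "'s \<Rightarrow> 'e"
  assumes proj_hom: "\<pi> \<in> ring_hom E S"
    and incl_closed: "s \<in> carrier S \<Longrightarrow> \<iota> s \<in> carrier E"
    and incl_add: "\<lbrakk>s \<in> carrier S; t \<in> carrier S\<rbrakk> \<Longrightarrow> \<iota> (s \<oplus>\<^bsub>S\<^esub> t) = \<iota> s \<oplus>\<^bsub>E\<^esub> \<iota> t"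
    and incl_mult: "\<lbrakk>s \<in> carrier S; t \<in> carrier S\<rbrakk> \<Longrightarrow> \<iota> (s \<otimes>\<^bsub>S\<^esub> t) = \<iota> s \<otimes>\<^bsub>E\<^esub> \<iota> t"
    and proj_incl: "s \<in> carrier S \<Longrightarrow> \<pi> (\<iota> s) = s"
    and incl_proj: "r \<in> carrier E \<Longrightarrow> \<iota> (\<pi> r) = \<iota> \<one>\<^bsub>S\<^esub> \<otimes>\<^bsub>E\<^esub> r"
    and idem_central: "r \<in> carrier E \<Longrightarrow> \<iota> \<one>\<^bsub>S\<^esub> \<otimes>\<^bsub>E\<^esub> r = r \<otimes>\<^bsub>E\<^esub> \<iota> \<one>\<^bsub>S\<^esub>"
begin

definition pullback_module :: "('s, 'm, 'z) module_scheme \<Rightarrow> ('e, 'm) module"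
  where "pullback_module N =
    \<lparr>carrier = carrier N, monoid.mult = undefined, one = undefined,
     ring.zero = \<zero>\<^bsub>N\<^esub>, ring.add = add N, smult = (\<lambda>r x. \<pi> r \<odot>\<^bsub>N\<^esub> x)\<rparr>"

text \<open>The fixed points of the idempotent are exactly its multiples. Taking them inside
  \<open>M\<close> keeps addition and zero, so a homomorphism restricts to corners as the same
  function.\<close>

definition corner_module :: "('e, 'm, 'z) module_scheme \<Rightarrow> ('s, 'm) module"
  where "corner_module M =
    \<lparr>carrier = {x \<in> carrier M. \<iota> \<one>\<^bsub>S\<^esub> \<odot>\<^bsub>M\<^esub> x = x}, monoid.mult = undefined, one = undefined,
     ring.zero = \<zero>\<^bsub>M\<^esub>, ring.add = add M, smult = (\<lambda>s x. \<iota> s \<odot>\<^bsub>M\<^esub> x)\<rparr>"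

lemma pullback_module_simps [simp]:
  "carrier (pullback_module N) = carrier N" "\<zero>\<^bsub>pullback_module N\<^esub> = \<zero>\<^bsub>N\<^esub>"
  "x \<oplus>\<^bsub>pullback_module N\<^esub> y = x \<oplus>\<^bsub>N\<^esub> y" "r \<odot>\<^bsub>pullback_module N\<^esub> x = \<pi> r \<odot>\<^bsub>N\<^esub> x"
  by (simp_all add: pullback_module_def)

lemma corner_module_simps [simp]:
  "x \<in> carrier (corner_module M) \<longleftrightarrow> x \<in> carrier M \<and> \<iota> \<one>\<^bsub>S\<^esub> \<odot>\<^bsub>M\<^esub> x = x"
  "\<zero>\<^bsub>corner_module M\<^esub> = \<zero>\<^bsub>M\<^esub>"
  "x \<oplus>\<^bsub>corner_module M\<^esub> y = x \<oplus>\<^bsub>M\<^esub> y" "s \<odot>\<^bsub>corner_module M\<^esub> x = \<iota> s \<odot>\<^bsub>M\<^esub> x"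
  by (simp_all add: corner_module_def)

lemma proj_closed: "r \<in> carrier E \<Longrightarrow> \<pi> r \<in> carrier S"
  using proj_hom by (rule ring_hom_closed)

lemma idem_closed: "\<iota> \<one>\<^bsub>S\<^esub> \<in> carrier E"
  by (simp add: incl_closed)

lemma idem_incl:
  assumes "s \<in> carrier S"
  shows "\<iota> \<one>\<^bsub>S\<^esub> \<otimes>\<^bsub>E\<^esub> \<iota> s = \<iota> s" "\<iota> s \<otimes>\<^bsub>E\<^esub> \<iota> \<one>\<^bsub>S\<^esub> = \<iota> s"
  using assms by (simp_all add: incl_mult[symmetric])

lemma proj_simps:
  "\<lbrakk>r \<in> carrier E; s \<in> carrier E\<rbrakk> \<Longrightarrow> \<pi> (r \<oplus>\<^bsub>E\<^esub> s) = \<pi> r \<oplus>\<^bsub>S\<^esub> \<pi> s"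
  "\<lbrakk>r \<in> carrier E; s \<in> carrier E\<rbrakk> \<Longrightarrow> \<pi> (r \<otimes>\<^bsub>E\<^esub> s) = \<pi> r \<otimes>\<^bsub>S\<^esub> \<pi> s"
  "\<pi> \<one>\<^bsub>E\<^esub> = \<one>\<^bsub>S\<^esub>"
  using proj_hom by (auto simp: ring_hom_def)

section \<open>Restriction of scalars and corners on modules and dual bases\<close>

lemma left_module_pullback:
  assumes "left_module S N"
  shows "left_module E (pullback_module N)"
proof -
  interpret N: left_module S N by fact
  show ?thesis
  proof (intro left_module.intro left_module_axioms.intro E.ring_axioms abelian_groupI, goal_cases)
    case (6 x) then show ?case by (intro bexI[of _ "\<ominus>\<^bsub>N\<^esub> x"]) (auto simp: N.M.l_neg)
  qed (auto simp: N.M.a_ac proj_closed proj_simps N.smult_l_distr N.smult_r_distr N.smult_assoc1)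
qed

lemma idem_smult_closed:
  assumes "left_module E M" "x \<in> carrier M"
  shows "\<iota> \<one>\<^bsub>S\<^esub> \<odot>\<^bsub>M\<^esub> x \<in> carrier (corner_module M)"
proof -
  interpret M: left_module E M by fact
  show ?thesis using assms(2) idem_closed
    by (simp add: M.smult_assoc1[symmetric] idem_incl)
qed

lemma idem_smult_incl:
  assumes "left_module E M" "s \<in> carrier S" "x \<in> carrier M"
  shows "\<iota> \<one>\<^bsub>S\<^esub> \<odot>\<^bsub>M\<^esub> (\<iota> s \<odot>\<^bsub>M\<^esub> x) = \<iota> s \<odot>\<^bsub>M\<^esub> x"
proof -
  interpret M: left_module E M by fact
  show ?thesis using assms(2,3) idem_closed incl_closed
    by (simp add: M.smult_assoc1[symmetric] idem_incl)
qed

lemma left_module_corner: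
  assumes "left_module E M"
  shows "left_module S (corner_module M)"
proof -
  interpret M: left_module E M by fact
  show ?thesis
  proof (intro left_module.intro left_module_axioms.intro S.ring_axioms abelian_groupI, goal_cases)
    case (6 x)
    then have x: "x \<in> carrier M" "\<iota> \<one>\<^bsub>S\<^esub> \<odot>\<^bsub>M\<^esub> x = x" by auto
    \<comment> \<open>Negatives stay in the corner: the last \<open>x\<close> is replaced by its
      multiple by the idempotent, which then acts on a sum equal to zero; uniqueness of negatives
      does the rest.\<close>
    have "\<iota> \<one>\<^bsub>S\<^esub> \<odot>\<^bsub>M\<^esub> (\<ominus>\<^bsub>M\<^esub> x) \<oplus>\<^bsub>M\<^esub> x = \<iota> \<one>\<^bsub>S\<^esub> \<odot>\<^bsub>M\<^esub> (\<ominus>\<^bsub>M\<^esub> x \<oplus>\<^bsub>M\<^esub> x)"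
      using x idem_closed by (simp add: M.smult_r_distr)
    also have "\<dots> = \<zero>\<^bsub>M\<^esub>" using x idem_closed by (simp add: M.M.l_neg)
    finally have "\<ominus>\<^bsub>M\<^esub> x = \<iota> \<one>\<^bsub>S\<^esub> \<odot>\<^bsub>M\<^esub> (\<ominus>\<^bsub>M\<^esub> x)"
      using x idem_closed by (intro M.M.minus_equality) auto
    then show ?case using x by (intro bexI[of _ "\<ominus>\<^bsub>M\<^esub> x"]) (auto simp: M.M.l_neg)
  qed (auto simp: M.M.a_ac incl_closed idem_closed incl_add incl_mult idem_smult_incl[OF assms]
      M.smult_l_distr M.smult_r_distr M.smult_assoc1)
qed

text \<open>Through \<open>\<iota>\<close> the ring \<open>S\<close> is a direct summand of the
  \<open>E\<close>-module \<open>E\<close>. So \<open>\<iota>\<close> turns \<open>S\<close>-valued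
  functionals into \<open>E\<close>-valued ones, and \<open>\<pi> (\<iota> s) = s\<close> keeps the
  expansion.\<close>

lemma fgp_module_pullback:
  assumes "fgp_module S N"
  shows "fgp_module E (pullback_module N)"
proof -
  from assms obtain n :: nat and x \<phi> where db: "dual_basis S N {..<n} x \<phi>" and N: "left_module S N"
    by (auto simp: fgp_module_def)
  interpret N: left_module S N by (rule N)
  interpret P: left_module E "pullback_module N" by (rule left_module_pullback[OF N])
  from db have x: "x \<in> {..<n} \<rightarrow> carrier N" "\<And>i. i < n \<Longrightarrow> \<phi> i \<in> linear_functionals S N"
    and eq: "\<And>y. y \<in> carrier N \<Longrightarrow> (\<Oplus>\<^bsub>N\<^esub>i\<in>{..<n}. \<phi> i y \<odot>\<^bsub>N\<^esub> x i) = y"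
    by (auto simp: dual_basis_def)
  note D = linear_functionalsD[OF x(2)]
  \<comment> \<open>\<open>\<iota>\<close> is \<open>E\<close>-linear:
    \<open>\<iota> (\<pi> r)\<close> is \<open>r\<close> times the idempotent by centrality, and
    \<open>\<iota> s\<close> absorbs the idempotent.\<close>
  have lin: "\<iota> (\<pi> r \<otimes>\<^bsub>S\<^esub> s) = r \<otimes>\<^bsub>E\<^esub> \<iota> s" if "r \<in> carrier E" "s \<in> carrier S" for r s
  proof -
    have "\<iota> (\<pi> r \<otimes>\<^bsub>S\<^esub> s) = r \<otimes>\<^bsub>E\<^esub> \<iota> \<one>\<^bsub>S\<^esub> \<otimes>\<^bsub>E\<^esub> \<iota> s"
      using that by (simp add: incl_mult proj_closed incl_proj idem_central)
    then show ?thesis using that by (simp add: E.m_assoc incl_closed idem_incl)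
  qed
  show ?thesis
  proof (rule fgp_moduleI[OF left_module_pullback[OF N]])
    show "dual_basis E (pullback_module N) {..<n} x (\<lambda>i y. \<iota> (\<phi> i y))"
      unfolding dual_basis_def
    proof (intro conjI ballI)
      show "(\<lambda>i y. \<iota> (\<phi> i y)) \<in> {..<n} \<rightarrow> linear_functionals E (pullback_module N)"
        using D by (auto intro!: linear_functionalsI simp: incl_closed incl_add proj_closed lin)
      fix y assume "y \<in> carrier (pullback_module N)"
      then have y: "y \<in> carrier N" by simp
      \<comment> \<open>Sums in \<open>N\<close> and in its restriction are taken in different
        records; the identity, viewed as an additive map, links them.\<close>
      have "y = (\<Oplus>\<^bsub>pullback_module N\<^esub>i\<in>{..<n}. \<phi> i y \<odot>\<^bsub>N\<^esub> x i)"
        using additive_hom_finsum[OF N.M.abelian_group_axioms P.M.abelian_group_axioms,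
            of "\<lambda>u. u" "{..<n}" "\<lambda>i. \<phi> i y \<odot>\<^bsub>N\<^esub> x i"] eq[OF y] x D y
        by (auto simp: Pi_def)
      also have "\<dots> = (\<Oplus>\<^bsub>pullback_module N\<^esub>i\<in>{..<n}. \<iota> (\<phi> i y) \<odot>\<^bsub>pullback_module N\<^esub> x i)"
        by (rule P.M.finsum_cong') (use x D y in \<open>auto simp: proj_incl incl_closed Pi_def\<close>)
      finally show "(\<Oplus>\<^bsub>pullback_module N\<^esub>i\<in>{..<n}. \<iota> (\<phi> i y) \<odot>\<^bsub>pullback_module N\<^esub> x i) = y"
        by (rule sym)
    qed (use x in auto)
  qed
qed

text \<open>The idempotent moves the elements into the corner and \<open>\<pi>\<close> makes the
  functionals \<open>S\<close>-valued. Multiplying the old expansion of \<open>y\<close> by the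
  idempotent, which fixes \<open>y\<close>, gives the new one.\<close>

lemma fgp_module_corner:
  assumes "fgp_module E M"
  shows "fgp_module S (corner_module M)"
proof -
  from assms obtain n :: nat and x \<phi> where db: "dual_basis E M {..<n} x \<phi>" and M: "left_module E M"
    by (auto simp: fgp_module_def)
  interpret M: left_module E M by (rule M)
  interpret C: left_module S "corner_module M" by (rule left_module_corner[OF M])
  from db have x: "\<And>i. i < n \<Longrightarrow> x i \<in> carrier M" "\<And>i. i < n \<Longrightarrow> \<phi> i \<in> linear_functionals E M"
    and eq: "\<And>y. y \<in> carrier M \<Longrightarrow> (\<Oplus>\<^bsub>M\<^esub>i\<in>{..<n}. \<phi> i y \<odot>\<^bsub>M\<^esub> x i) = y"
    by (auto simp: dual_basis_def)
  note D = linear_functionalsD[OF x(2)]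
  \<comment> \<open>\<open>\<iota> (\<pi> r)\<close> absorbs the idempotent on its right and equals
    the idempotent times \<open>r\<close>.\<close>
  have ip: "\<iota> (\<pi> r) \<odot>\<^bsub>M\<^esub> (\<iota> \<one>\<^bsub>S\<^esub> \<odot>\<^bsub>M\<^esub> u) = \<iota> \<one>\<^bsub>S\<^esub> \<odot>\<^bsub>M\<^esub> (r \<odot>\<^bsub>M\<^esub> u)"
    if "r \<in> carrier E" "u \<in> carrier M" for r u
  proof -
    have "\<iota> (\<pi> r) \<otimes>\<^bsub>E\<^esub> \<iota> \<one>\<^bsub>S\<^esub> = \<iota> \<one>\<^bsub>S\<^esub> \<otimes>\<^bsub>E\<^esub> r"
      using idem_incl(2)[OF proj_closed[OF that(1)]] incl_proj[OF that(1)] by simp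
    then show ?thesis
      using that by (simp add: M.smult_assoc1[symmetric] incl_closed proj_closed idem_closed)
  qed
  show ?thesis
  proof (rule fgp_moduleI[OF left_module_corner[OF M]])
    show "dual_basis S (corner_module M) {..<n} (\<lambda>i. \<iota> \<one>\<^bsub>S\<^esub> \<odot>\<^bsub>M\<^esub> x i) (\<lambda>i y. \<pi> (\<phi> i y))"
      unfolding dual_basis_def
    proof (intro conjI ballI)
      show "(\<lambda>i y. \<pi> (\<phi> i y)) \<in> {..<n} \<rightarrow> linear_functionals S (corner_module M)"
        using D by (auto intro!: linear_functionalsI simp: incl_closed proj_closed proj_simps proj_incl)
      show "(\<lambda>i. \<iota> \<one>\<^bsub>S\<^esub> \<odot>\<^bsub>M\<^esub> x i) \<in> {..<n} \<rightarrow> carrier (corner_module M)"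
        using idem_smult_closed[OF M x(1)] by auto
      fix y assume "y \<in> carrier (corner_module M)"
      then have y: "y \<in> carrier M" "\<iota> \<one>\<^bsub>S\<^esub> \<odot>\<^bsub>M\<^esub> y = y" by auto
      have "y = \<iota> \<one>\<^bsub>S\<^esub> \<odot>\<^bsub>M\<^esub> (\<Oplus>\<^bsub>M\<^esub>i\<in>{..<n}. \<phi> i y \<odot>\<^bsub>M\<^esub> x i)" using eq[OF y(1)] y(2) by simp
      also have "\<dots> = (\<Oplus>\<^bsub>corner_module M\<^esub>i\<in>{..<n}. \<iota> \<one>\<^bsub>S\<^esub> \<odot>\<^bsub>M\<^esub> (\<phi> i y \<odot>\<^bsub>M\<^esub> x i))"
        by (rule additive_hom_finsum[OF M.M.abelian_group_axioms C.M.abelian_group_axioms])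
          (use x D y idem_smult_closed[OF M] in \<open>auto simp: M.smult_r_distr idem_closed\<close>)
      also have "\<dots> = (\<Oplus>\<^bsub>corner_module M\<^esub>i\<in>{..<n}. \<pi> (\<phi> i y) \<odot>\<^bsub>corner_module M\<^esub> (\<iota> \<one>\<^bsub>S\<^esub> \<odot>\<^bsub>M\<^esub> x i))"
      proof (rule C.M.finsum_cong'[OF refl])
        show "(\<lambda>i. \<pi> (\<phi> i y) \<odot>\<^bsub>corner_module M\<^esub> (\<iota> \<one>\<^bsub>S\<^esub> \<odot>\<^bsub>M\<^esub> x i)) \<in> {..<n} \<rightarrow> carrier (corner_module M)"
          using idem_smult_closed[OF M x(1)] D y by (intro Pi_I C.smult_closed proj_closed) auto
      qed (use x D y ip in auto)
      finally show "(\<Oplus>\<^bsub>corner_module M\<^esub>i\<in>{..<n}. \<pi> (\<phi> i y) \<odot>\<^bsub>corner_module M\<^esub> (\<iota> \<one>\<^bsub>S\<^esub> \<odot>\<^bsub>M\<^esub> x i)) = y"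
        by (rule sym)
    qed auto
  qed
qed

section \<open>Exactness of restriction and corner\<close>

lemma pullback_hom:
  "h \<in> left_module_hom S K L \<Longrightarrow> h \<in> left_module_hom E (pullback_module K) (pullback_module L)"
  by (auto simp: left_module_hom_def proj_closed)

lemma corner_hom:
  assumes h: "h \<in> left_module_hom E K L"
  shows "h \<in> left_module_hom S (corner_module K) (corner_module L)"
proof (rule left_module_homI)
  fix x assume "x \<in> carrier (corner_module K)"
  then have x: "x \<in> carrier K" "\<iota> \<one>\<^bsub>S\<^esub> \<odot>\<^bsub>K\<^esub> x = x" by auto
  then show "h x \<in> carrier (corner_module L)"
    using left_module_homD(1)[OF h x(1)] left_module_homD(3)[OF h idem_closed x(1)] by simp
qed (use left_module_homD[OF h] in \<open>auto simp: incl_closed\<close>)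

text \<open>This is exactness of the corner functor: if the idempotent fixes \<open>h x\<close>,
  then multiplying \<open>x\<close> by it gives a preimage of the same value inside the
  corner.\<close>

lemma corner_hom_image:
  assumes K: "left_module E K" and h: "h \<in> left_module_hom E K L"
  shows "h ` carrier (corner_module K) = h ` carrier K \<inter> carrier (corner_module L)"
proof (intro equalityI subsetI)
  fix y assume "y \<in> h ` carrier K \<inter> carrier (corner_module L)"
  then obtain x where x: "x \<in> carrier K" "y = h x" "\<iota> \<one>\<^bsub>S\<^esub> \<odot>\<^bsub>L\<^esub> h x = h x" by auto
  then have "y = h (\<iota> \<one>\<^bsub>S\<^esub> \<odot>\<^bsub>K\<^esub> x)"
    using left_module_homD(3)[OF h idem_closed x(1)] by simp
  then show "y \<in> h ` carrier (corner_module K)"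
    using idem_smult_closed[OF K x(1)] by blast
qed (use left_module_homD(1)[OF corner_hom[OF h]] in auto)

text \<open>Restriction of scalars changes neither carriers nor zeros nor maps, so the exactness
  conditions carry over verbatim.\<close>

lemma perfect_module_pullback:
  assumes "perfect_module S N"
  shows "perfect_module E (pullback_module N)"
proof -
  obtain P :: "nat \<Rightarrow> ('s, nat \<Rightarrow> 's) module" and d e n where res: "fgp_resolution S N P d e n"
    using assms perfect_module_iff_resolution by fast
  have "fgp_resolution E (pullback_module N) (\<lambda>i. pullback_module (P i)) d e n"
    using res by (simp add: fgp_resolution_def fgp_module_pullback pullback_hom)
  then show ?thesis by (rule perfect_moduleI)
qed

text \<open>Instead of an isomorphism from the corner of \<open>M\<close> to \<open>N\<close>, a
  surjection \<open>\<tau>\<close> on all of \<open>M\<close> that is semilinear over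
  \<open>\<pi>\<close> is given, with kernel killed by the idempotent. It is automatically bijective
  on the corner; the projection of a product algebra onto a factor has this form.\<close>

lemma perfect_module_corner:
  assumes M: "left_module E M" and N: "left_module S N" and perf: "perfect_module E M"
    and \<tau>: "\<tau> ` carrier M = carrier N"
    and \<tau>_add: "\<And>x y. \<lbrakk>x \<in> carrier M; y \<in> carrier M\<rbrakk> \<Longrightarrow> \<tau> (x \<oplus>\<^bsub>M\<^esub> y) = \<tau> x \<oplus>\<^bsub>N\<^esub> \<tau> y"
    and \<tau>_smult: "\<And>r x. \<lbrakk>r \<in> carrier E; x \<in> carrier M\<rbrakk> \<Longrightarrow> \<tau> (r \<odot>\<^bsub>M\<^esub> x) = \<pi> r \<odot>\<^bsub>N\<^esub> \<tau> x"
    and \<tau>_ker: "\<And>x. \<lbrakk>x \<in> carrier M; \<tau> x = \<zero>\<^bsub>N\<^esub>\<rbrakk> \<Longrightarrow> \<iota> \<one>\<^bsub>S\<^esub> \<odot>\<^bsub>M\<^esub> x = \<zero>\<^bsub>M\<^esub>"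
  shows "perfect_module S N"
proof -
  interpret M: left_module E M by fact
  interpret N: left_module S N by fact
  have \<tau>_zero: "\<tau> \<zero>\<^bsub>M\<^esub> = \<zero>\<^bsub>N\<^esub>"
    by (rule additive_hom_zero[OF M.M.abelian_group_axioms N.M.abelian_group_axioms])
      (use \<tau> \<tau>_add in auto)
  obtain P :: "nat \<Rightarrow> ('e, nat \<Rightarrow> 'e) module" and d e n where "fgp_resolution E M P d e n"
    using perf perfect_module_iff_resolution by fast
  then have P: "\<And>i. fgp_module E (P i)"
    and d: "\<And>i. d i \<in> left_module_hom E (P (Suc i)) (P i)" and e: "e \<in> left_module_hom E (P 0) M"
    and e_img: "e ` carrier (P 0) = carrier M"
    and d0: "d 0 ` carrier (P (Suc 0)) = {x \<in> carrier (P 0). e x = \<zero>\<^bsub>M\<^esub>}"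
    and dS: "\<And>i. d (Suc i) ` carrier (P (Suc (Suc i))) = {x \<in> carrier (P (Suc i)). d i x = \<zero>\<^bsub>P i\<^esub>}"
    and fin: "\<And>i. i > n \<Longrightarrow> carrier (P i) = {\<zero>\<^bsub>P i\<^esub>}"
    by (simp_all add: fgp_resolution_def)
  have lm: "left_module E (P i)" for i using P by (simp add: fgp_module_def)
  interpret P: left_module E "P i" for i by (rule lm)
  let ?\<epsilon> = "\<iota> \<one>\<^bsub>S\<^esub>"
  let ?C = "\<lambda>i. corner_module (P i)"
  have "fgp_resolution S N ?C d (\<lambda>x. \<tau> (e x)) n"
    unfolding fgp_resolution_def
  proof (intro conjI allI impI)
    show "(\<lambda>x. \<tau> (e x)) \<in> left_module_hom S (?C 0) N"
      using left_module_homD[OF e] \<tau> \<tau>_add \<tau>_smult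
      by (intro left_module_homI) (auto simp: incl_closed proj_incl)
    show "(\<lambda>x. \<tau> (e x)) ` carrier (?C 0) = carrier N"
    proof (intro equalityI subsetI)
      fix y assume "y \<in> carrier N"
      then obtain x where x: "x \<in> carrier (P 0)" "y = \<tau> (e x)" using \<tau> e_img by (metis imageE)
      \<comment> \<open>\<open>\<pi>\<close> sends the idempotent to the unit of \<open>S\<close>,
        so moving \<open>x\<close> into the corner does not change its image in
        \<open>N\<close>.\<close>
      have "\<tau> (e (?\<epsilon> \<odot>\<^bsub>P 0\<^esub> x)) = \<pi> ?\<epsilon> \<odot>\<^bsub>N\<^esub> \<tau> (e x)"
        using left_module_homD[OF e] x \<tau>_smult idem_closed by simp
      also have "\<dots> = y" using x \<open>y \<in> carrier N\<close> by (simp add: proj_incl)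
      finally show "y \<in> (\<lambda>x. \<tau> (e x)) ` carrier (?C 0)"
        using idem_smult_closed[OF lm x(1)] by (metis imageI)
    qed (use left_module_homD(1)[OF e] \<tau> in auto)
    \<comment> \<open>For \<open>x\<close> in the corner the idempotent fixes \<open>e x\<close>,
      yet it kills the kernel of \<open>\<tau>\<close>; so composing with \<open>\<tau>\<close>
      enlarges no kernel.\<close>
    have "\<tau> (e x) = \<zero>\<^bsub>N\<^esub> \<longleftrightarrow> e x = \<zero>\<^bsub>M\<^esub>" if "x \<in> carrier (?C 0)" for x
    proof
      assume "\<tau> (e x) = \<zero>\<^bsub>N\<^esub>"
      then have "?\<epsilon> \<odot>\<^bsub>M\<^esub> e x = \<zero>\<^bsub>M\<^esub>" using \<tau>_ker left_module_homD(1)[OF e] that by simp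
      then show "e x = \<zero>\<^bsub>M\<^esub>" using left_module_homD(3)[OF e idem_closed] that by (metis corner_module_simps(1))
    qed (simp add: \<tau>_zero)
    then show "d 0 ` carrier (?C 1) = {x \<in> carrier (?C 0). \<tau> (e x) = \<zero>\<^bsub>N\<^esub>}"
      using corner_hom_image[OF lm d, of 0] by (auto simp: d0 \<tau>_zero)
  next
    fix i show "d (Suc i) ` carrier (?C (Suc (Suc i))) = {x \<in> carrier (?C (Suc i)). d i x = \<zero>\<^bsub>?C i\<^esub>}"
      using corner_hom_image[OF lm d, of "Suc i"] by (auto simp: dS)
  next
    fix i assume "i > n"
    then show "carrier (?C i) = {\<zero>\<^bsub>?C i\<^esub>}"
      using fin[of i] P.smult_r_null[OF idem_closed, of i] by (auto simp: set_eq_iff)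
  qed (use P fgp_module_corner corner_hom[OF d] in auto)
  then show ?thesis by (rule perfect_moduleI)
qed

end

section \<open>Functoriality of the enveloping algebra\<close>

text \<open>Algebra maps are not required to preserve the unit: the inclusions \<open>A \<rightarrow> A \<oplus> B\<close> do not.\<close>

definition algebra_maps ::
    "('r, 'x) ring_scheme \<Rightarrow> ('r, 'a, 'y) module_scheme \<Rightarrow> ('r, 'b, 'z) module_scheme \<Rightarrow> ('a \<Rightarrow> 'b) set"
  where "algebra_maps R A B =
    {f \<in> left_module_hom R A B. \<forall>x\<in>carrier A. \<forall>y\<in>carrier A. f (x \<otimes>\<^bsub>A\<^esub> y) = f x \<otimes>\<^bsub>B\<^esub> f y}"

lemma algebra_mapsD:
  assumes "f \<in> algebra_maps R A B"
  shows "x \<in> carrier A \<Longrightarrow> f x \<in> carrier B"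
    and "\<lbrakk>x \<in> carrier A; y \<in> carrier A\<rbrakk> \<Longrightarrow> f (x \<oplus>\<^bsub>A\<^esub> y) = f x \<oplus>\<^bsub>B\<^esub> f y"
    and "\<lbrakk>r \<in> carrier R; x \<in> carrier A\<rbrakk> \<Longrightarrow> f (r \<odot>\<^bsub>A\<^esub> x) = r \<odot>\<^bsub>B\<^esub> f x"
    and "\<lbrakk>x \<in> carrier A; y \<in> carrier A\<rbrakk> \<Longrightarrow> f (x \<otimes>\<^bsub>A\<^esub> y) = f x \<otimes>\<^bsub>B\<^esub> f y"
  using assms by (auto simp: algebra_maps_def left_module_hom_def)

lemma opposite_algebra_simps:
  "carrier (opposite_algebra A) = carrier A" "add (opposite_algebra A) = add A"
  "\<one>\<^bsub>opposite_algebra A\<^esub> = \<one>\<^bsub>A\<^esub>" "x \<otimes>\<^bsub>opposite_algebra A\<^esub> y = y \<otimes>\<^bsub>A\<^esub> x"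
  "smult (opposite_algebra A) = smult A"
  by (simp_all add: opposite_algebra_def)

lemma algebra_maps_opposite:
  "f \<in> algebra_maps R A B \<Longrightarrow> f \<in> algebra_maps R (opposite_algebra A) (opposite_algebra B)"
  by (auto simp: algebra_maps_def left_module_hom_def opposite_algebra_simps)

text \<open>A lift of \<open>f \<otimes> g\<close> to the free abelian groups on pairs, before the
  relations are divided out.\<close>

definition pair_map :: "('a \<Rightarrow> 'c) \<Rightarrow> ('b \<Rightarrow> 'd) \<Rightarrow> ('a \<times> 'b \<Rightarrow>\<^sub>0 int) \<Rightarrow> ('c \<times> 'd \<Rightarrow>\<^sub>0 int)"
  where "pair_map f g = frag_extend (\<lambda>p. frag_of (f (fst p), g (snd p)))"

lemma pair_map_simps [simp]:
  "pair_map f g 0 = 0" "pair_map f g (frag_of (a, b)) = frag_of (f a, g b)"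
  "pair_map f g (u - v) = pair_map f g u - pair_map f g v"
  "pair_map f g (u + v) = pair_map f g u + pair_map f g v"
  "pair_map f g (- u) = - pair_map f g u"
  by (simp_all add: pair_map_def frag_extend_diff frag_extend_add frag_extend_minus)

lemma pair_map_closed:
  fixes A :: "('a, 'y) ring_scheme" and B :: "('b, 'z) ring_scheme"
    and A' :: "('c, 'u) ring_scheme" and B' :: "('d, 'v) ring_scheme"
  assumes "f \<in> carrier A \<rightarrow> carrier A'" "g \<in> carrier B \<rightarrow> carrier B'"
    and "Poly_Mapping.keys h \<subseteq> carrier A \<times> carrier B"
  shows "Poly_Mapping.keys (pair_map f g h) \<subseteq> carrier A' \<times> carrier B'"
  using assms(3)
proof (induction h rule: pair_ring_induct)
  case (diff u v)
  then show ?case using keys_diff[of "pair_map f g u" "pair_map f g v"] by (auto simp: subset_eq)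
qed (use assms in auto)

lemma pair_map_mult:
  fixes A :: "('a, 'y) ring_scheme" and B :: "('b, 'z) ring_scheme"
    and A' :: "('c, 'u) ring_scheme" and B' :: "('d, 'v) ring_scheme"
  assumes "\<And>x y. \<lbrakk>x \<in> carrier A; y \<in> carrier A\<rbrakk> \<Longrightarrow> f (x \<otimes>\<^bsub>A\<^esub> y) = f x \<otimes>\<^bsub>A'\<^esub> f y"
    and "\<And>x y. \<lbrakk>x \<in> carrier B; y \<in> carrier B\<rbrakk> \<Longrightarrow> g (x \<otimes>\<^bsub>B\<^esub> y) = g x \<otimes>\<^bsub>B'\<^esub> g y"
    and "Poly_Mapping.keys u \<subseteq> carrier A \<times> carrier B" "Poly_Mapping.keys v \<subseteq> carrier A \<times> carrier B"
  shows "pair_map f g (u \<otimes>\<^bsub>pair_ring A B\<^esub> v) = pair_map f g u \<otimes>\<^bsub>pair_ring A' B'\<^esub> pair_map f g v"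
  using assms(3)
proof (induction u rule: pair_ring_induct)
  case (of a b)
  from assms(4) show ?case
    by (induction v rule: pair_ring_induct) (use of assms(1,2) in \<open>auto simp: pair_mult_diff\<close>)
qed (auto simp: pair_mult_diff)

lemma pair_ring_uminus:
  assumes "ring A" "ring B" "Poly_Mapping.keys h \<subseteq> carrier A \<times> carrier B"
  shows "\<ominus>\<^bsub>pair_ring A B\<^esub> h = - h"
proof -
  interpret ring "pair_ring A B" by (rule ring_pair_ring) fact+
  show ?thesis using assms(3) by (intro minus_equality) auto
qed

section \<open>Tensor rings and tensor maps by representatives\<close>

locale tensor_product = A: assoc_algebra R A + B: assoc_algebra R B
  for R :: "('r, 'x) ring_scheme" and A :: "('r, 'a, 'y) module_scheme" and B :: "('r, 'b, 'z) module_scheme"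
begin

sublocale relations: ideal "tensor_relations R A B" "pair_ring A B"
  by (rule ideal_tensor_relations) unfold_locales

definition coset :: "('a \<times> 'b \<Rightarrow>\<^sub>0 int) \<Rightarrow> ('a \<times> 'b \<Rightarrow>\<^sub>0 int) set"
  where "coset h = tensor_relations R A B +>\<^bsub>pair_ring A B\<^esub> h"

lemma coset_simps:
  "h \<in> carrier (pair_ring A B) \<Longrightarrow> coset h \<in> carrier (tensor_ring R A B)"
  "\<lbrakk>u \<in> carrier (pair_ring A B); v \<in> carrier (pair_ring A B)\<rbrakk> \<Longrightarrow>
    coset u \<oplus>\<^bsub>tensor_ring R A B\<^esub> coset v = coset (u + v)"
  "\<lbrakk>u \<in> carrier (pair_ring A B); v \<in> carrier (pair_ring A B)\<rbrakk> \<Longrightarrow>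
    coset u \<otimes>\<^bsub>tensor_ring R A B\<^esub> coset v = coset (u \<otimes>\<^bsub>pair_ring A B\<^esub> v)"
  "\<one>\<^bsub>tensor_ring R A B\<^esub> = coset (frag_of (\<one>\<^bsub>A\<^esub>, \<one>\<^bsub>B\<^esub>))"
  using relations.rcos_ring_hom
  by (auto simp: coset_def tensor_ring_def ring_hom_def simp del: pair_ring_simps(1))

lemma cosetE:
  assumes "t \<in> carrier (tensor_ring R A B)"
  obtains h where "Poly_Mapping.keys h \<subseteq> carrier A \<times> carrier B" "t = coset h"
  using assms by (auto simp: coset_def tensor_ring_def FactRing_def A_RCOSETS_def')

lemma coset_eqI:
  assumes "h \<in> coset u" "Poly_Mapping.keys u \<subseteq> carrier A \<times> carrier B"
  shows "coset h = coset u"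
  using relations.a_repr_independence[OF _ _ relations.a_subgroup, of h u] assms by (simp add: coset_def)

end

text \<open>A coset is the set of its representatives, so mapping all of them and taking the single
  resulting coset avoids a choice. That there is only one is shown in
  \<open>tensor_map_coset\<close>.\<close>

definition tensor_map ::
    "('r, 'x) ring_scheme \<Rightarrow> ('r, 'c, 'y) module_scheme \<Rightarrow> ('r, 'd, 'z) module_scheme
      \<Rightarrow> ('a \<Rightarrow> 'c) \<Rightarrow> ('b \<Rightarrow> 'd) \<Rightarrow> ('a \<times> 'b \<Rightarrow>\<^sub>0 int) set \<Rightarrow> ('c \<times> 'd \<Rightarrow>\<^sub>0 int) set"
  where "tensor_map R A' B' f g t =
    the_elem ((\<lambda>h. tensor_relations R A' B' +>\<^bsub>pair_ring A' B'\<^esub> pair_map f g h) ` t)"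

text \<open>Each of the three kinds of generating relation goes to one of the same kind, by
  additivity or by homogeneity of \<open>f\<close> and \<open>g\<close>.\<close>

lemma pair_map_relations:
  assumes alg: "assoc_algebra R A" "assoc_algebra R B" "assoc_algebra R A'" "assoc_algebra R B'"
    and f: "f \<in> left_module_hom R A A'" and g: "g \<in> left_module_hom R B B'"
    and h: "h \<in> tensor_relations R A B"
  shows "pair_map f g h \<in> tensor_relations R A' B'"
proof -
  interpret T: tensor_product R A B by (intro tensor_product.intro alg)
  interpret T': tensor_product R A' B' by (intro tensor_product.intro alg)
  note fD = left_module_homD[OF f] and gD = left_module_homD[OF g]
  have gen: "pair_map f g u \<in> tensor_generators R A' B'" if "u \<in> tensor_generators R A B" for u
  proof -
    from that consider
        (1) a a' b where "u = frag_of (a \<oplus>\<^bsub>A\<^esub> a', b) - frag_of (a, b) - frag_of (a', b)"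
          "a \<in> carrier A" "a' \<in> carrier A" "b \<in> carrier B"
      | (2) a b b' where "u = frag_of (a, b \<oplus>\<^bsub>B\<^esub> b') - frag_of (a, b) - frag_of (a, b')"
          "a \<in> carrier A" "b \<in> carrier B" "b' \<in> carrier B"
      | (3) r a b where "u = frag_of (r \<odot>\<^bsub>A\<^esub> a, b) - frag_of (a, r \<odot>\<^bsub>B\<^esub> b)"
          "r \<in> carrier R" "a \<in> carrier A" "b \<in> carrier B"
      unfolding tensor_generators_def by blast
    then show ?thesis
    proof cases
      case 1
      have "frag_of (f a \<oplus>\<^bsub>A'\<^esub> f a', g b) - frag_of (f a, g b) - frag_of (f a', g b) \<in> tensor_generators R A' B'"
        unfolding tensor_generators_def using 1 fD(1) gD(1) by blast
      then show ?thesis using 1 by (simp add: fD)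
    next
      case 2
      have "frag_of (f a, g b \<oplus>\<^bsub>B'\<^esub> g b') - frag_of (f a, g b) - frag_of (f a, g b') \<in> tensor_generators R A' B'"
        unfolding tensor_generators_def using 2 fD(1) gD(1) by blast
      then show ?thesis using 2 by (simp add: gD)
    next
      case 3
      have "frag_of (r \<odot>\<^bsub>A'\<^esub> f a, g b) - frag_of (f a, r \<odot>\<^bsub>B'\<^esub> g b) \<in> tensor_generators R A' B'"
        unfolding tensor_generators_def using 3 fD(1) gD(1) by blast
      then show ?thesis using 3 by (simp add: fD gD)
    qed
  qed
  have incl: "u \<in> tensor_relations R A B" if "u \<in> tensor_generators R A B" for u
    unfolding tensor_relations_def using that by (rule generate.incl)
  have incl': "pair_map f g u \<in> tensor_relations R A' B'" if "u \<in> tensor_generators R A B" for u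
    unfolding tensor_relations_def using gen[OF that] by (rule generate.incl)
  have "h \<in> generate (add_monoid (pair_ring A B)) (tensor_generators R A B)"
    using h by (simp only: tensor_relations_def)
  then show ?thesis
  proof (induction h rule: generate.induct)
    case one
    then show ?case
      using additive_subgroup.zero_closed[OF T'.relations.is_additive_subgroup] by simp
  next
    case (incl u) then show ?case by (rule incl')
  next
    \<comment> \<open>\<open>generate\<close> speaks of the inverse in the group record; on both
      sides it is identified with \<open>-\<close>, with which \<open>pair_map\<close>
      commutes.\<close>
    case (inv u)
    have k: "Poly_Mapping.keys u \<subseteq> carrier A \<times> carrier B"
      using subsetD[OF T.relations.a_subset incl[OF inv]] by simp
    have k': "Poly_Mapping.keys (pair_map f g u) \<subseteq> carrier A' \<times> carrier B'"
      using subsetD[OF T'.relations.a_subset incl'[OF inv]] by simp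
    have "\<ominus>\<^bsub>pair_ring A' B'\<^esub> pair_map f g u \<in> tensor_relations R A' B'"
      using additive_subgroup.a_inv_closed[OF T'.relations.is_additive_subgroup incl'[OF inv]] .
    then show ?case
      using pair_ring_uminus[OF T.A.ring_axioms T.B.ring_axioms k]
        pair_ring_uminus[OF T'.A.ring_axioms T'.B.ring_axioms k']
      by (simp add: a_inv_def)
  next
    case (eng u v)
    then show ?case
      using additive_subgroup.a_closed[OF T'.relations.is_additive_subgroup eng.IH] by simp
  qed
qed

locale tensor_functor = T: tensor_product R A B + T': tensor_product R A' B'
  for R :: "('r, 'x) ring_scheme"
    and A :: "('r, 'a, 'y) module_scheme" and B :: "('r, 'b, 'z) module_scheme"
    and A' :: "('r, 'c, 'u) module_scheme" and B' :: "('r, 'd, 'v) module_scheme" +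
  fixes f g
  assumes f: "f \<in> algebra_maps R A A'" and g: "g \<in> algebra_maps R B B'"
begin

lemma pair_map_carrier:
  "h \<in> carrier (pair_ring A B) \<Longrightarrow> pair_map f g h \<in> carrier (pair_ring A' B')"
  using pair_map_closed[of f A A' g B B'] algebra_mapsD(1)[OF f] algebra_mapsD(1)[OF g] by auto

text \<open>Two representatives differ by a relation, which \<open>pair_map\<close> sends to a
  relation, so all of them yield one coset.\<close>

lemma tensor_map_coset:
  assumes h: "h \<in> carrier (pair_ring A B)"
  shows "tensor_map R A' B' f g (T.coset h) = T'.coset (pair_map f g h)"
proof -
  have eq: "T'.coset (pair_map f g u) = T'.coset (pair_map f g h)" if "u \<in> T.coset h" for u
  proof -
    obtain v where v: "v \<in> tensor_relations R A B" "u = v + h"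
      using \<open>u \<in> T.coset h\<close> by (auto simp: T.coset_def a_r_coset_def')
    have "pair_map f g v \<in> tensor_relations R A' B'"
      using pair_map_relations[OF T.A.assoc_algebra_axioms T.B.assoc_algebra_axioms
          T'.A.assoc_algebra_axioms T'.B.assoc_algebra_axioms _ _ v(1)] f g
      by (simp add: algebra_maps_def)
    then have "pair_map f g u \<in> T'.coset (pair_map f g h)"
      by (auto simp: T'.coset_def a_r_coset_def' v(2))
    then show ?thesis using pair_map_carrier[OF h] by (intro T'.coset_eqI) auto
  qed
  have "h \<in> T.coset h"
    unfolding T.coset_def by (rule T.relations.a_rcos_self[OF h])
  then have "(\<lambda>_. T'.coset (pair_map f g h)) ` T.coset h = {T'.coset (pair_map f g h)}"
    by (rule image_constant)
  moreover have "(\<lambda>u. T'.coset (pair_map f g u)) ` T.coset h = (\<lambda>_. T'.coset (pair_map f g h)) ` T.coset h"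
    by (rule image_cong[OF refl eq])
  ultimately have "(\<lambda>u. T'.coset (pair_map f g u)) ` T.coset h = {T'.coset (pair_map f g h)}" by simp
  then show ?thesis by (simp add: tensor_map_def T'.coset_def)
qed

text \<open>There is no clause for the unit: for the inclusions its image is an idempotent that need
  not be the unit.\<close>

lemma tensor_map_simps:
  "t \<in> carrier (tensor_ring R A B) \<Longrightarrow> tensor_map R A' B' f g t \<in> carrier (tensor_ring R A' B')"
  "\<lbrakk>s \<in> carrier (tensor_ring R A B); t \<in> carrier (tensor_ring R A B)\<rbrakk> \<Longrightarrow>
    tensor_map R A' B' f g (s \<oplus>\<^bsub>tensor_ring R A B\<^esub> t) =
      tensor_map R A' B' f g s \<oplus>\<^bsub>tensor_ring R A' B'\<^esub> tensor_map R A' B' f g t"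
  "\<lbrakk>s \<in> carrier (tensor_ring R A B); t \<in> carrier (tensor_ring R A B)\<rbrakk> \<Longrightarrow>
    tensor_map R A' B' f g (s \<otimes>\<^bsub>tensor_ring R A B\<^esub> t) =
      tensor_map R A' B' f g s \<otimes>\<^bsub>tensor_ring R A' B'\<^esub> tensor_map R A' B' f g t"
proof -
  have mult: "pair_map f g (u \<otimes>\<^bsub>pair_ring A B\<^esub> v) = pair_map f g u \<otimes>\<^bsub>pair_ring A' B'\<^esub> pair_map f g v"
    if "u \<in> carrier (pair_ring A B)" "v \<in> carrier (pair_ring A B)" for u v
    by (rule pair_map_mult) (use that algebra_mapsD(4)[OF f] algebra_mapsD(4)[OF g] in auto)
  have ex: "\<exists>h. h \<in> carrier (pair_ring A B) \<and> t = T.coset h" if "t \<in> carrier (tensor_ring R A B)" for t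
    by (rule T.cosetE[OF that]) auto
  note [simp del] = pair_ring_simps(1)
  show "tensor_map R A' B' f g t \<in> carrier (tensor_ring R A' B')" if "t \<in> carrier (tensor_ring R A B)"
  proof -
    obtain h where "h \<in> carrier (pair_ring A B)" "t = T.coset h" using ex[OF \<open>t \<in> _\<close>] by blast
    then show ?thesis by (simp add: tensor_map_coset T'.coset_simps pair_map_carrier)
  qed
  show "tensor_map R A' B' f g (s \<oplus>\<^bsub>tensor_ring R A B\<^esub> t) =
      tensor_map R A' B' f g s \<oplus>\<^bsub>tensor_ring R A' B'\<^esub> tensor_map R A' B' f g t"
    if st: "s \<in> carrier (tensor_ring R A B)" "t \<in> carrier (tensor_ring R A B)"
  proof -
    obtain u v where uv: "u \<in> carrier (pair_ring A B)" "s = T.coset u" "v \<in> carrier (pair_ring A B)" "t = T.coset v"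
      using ex[OF st(1)] ex[OF st(2)] by blast
    then show ?thesis using T.relations.add.m_closed[OF uv(1,3)]
      by (simp add: tensor_map_coset T.coset_simps T'.coset_simps pair_map_carrier)
  qed
  show "tensor_map R A' B' f g (s \<otimes>\<^bsub>tensor_ring R A B\<^esub> t) =
      tensor_map R A' B' f g s \<otimes>\<^bsub>tensor_ring R A' B'\<^esub> tensor_map R A' B' f g t"
    if st: "s \<in> carrier (tensor_ring R A B)" "t \<in> carrier (tensor_ring R A B)"
  proof -
    obtain u v where uv: "u \<in> carrier (pair_ring A B)" "s = T.coset u" "v \<in> carrier (pair_ring A B)" "t = T.coset v"
      using ex[OF st(1)] ex[OF st(2)] by blast
    then show ?thesis using T.relations.m_closed[OF uv(1,3)]
      by (simp add: tensor_map_coset T.coset_simps T'.coset_simps pair_map_carrier mult)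
  qed
qed

end

section \<open>Compatibility of algebra maps with the bimodule action\<close>

lemma regular_bimodule_simps:
  "carrier (regular_bimodule A) = carrier A" "add (regular_bimodule A) = add A"
  "\<zero>\<^bsub>regular_bimodule A\<^esub> = \<zero>\<^bsub>A\<^esub>"
  by (simp_all add: regular_bimodule_def)

text \<open>On a generator this is \<open>f (a x b) = f a f x f b\<close>; both sides are additive
  in \<open>h\<close>.\<close>

lemma pair_action_map:
  assumes A: "ring A" and B: "ring B"
    and f: "\<And>x. x \<in> carrier A \<Longrightarrow> f x \<in> carrier B"
      "\<And>x y. \<lbrakk>x \<in> carrier A; y \<in> carrier A\<rbrakk> \<Longrightarrow> f (x \<oplus>\<^bsub>A\<^esub> y) = f x \<oplus>\<^bsub>B\<^esub> f y"
      "\<And>x y. \<lbrakk>x \<in> carrier A; y \<in> carrier A\<rbrakk> \<Longrightarrow> f (x \<otimes>\<^bsub>A\<^esub> y) = f x \<otimes>\<^bsub>B\<^esub> f y"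
    and h: "Poly_Mapping.keys h \<subseteq> carrier A \<times> carrier A" and x: "x \<in> carrier A"
  shows "f (pair_action A h x) = pair_action B (pair_map f f h) (f x)"
proof -
  interpret A: ring A by fact
  interpret B: ring B by fact
  have f0: "f \<zero>\<^bsub>A\<^esub> = \<zero>\<^bsub>B\<^esub>"
    by (rule additive_hom_zero[OF A.abelian_group_axioms B.abelian_group_axioms]) (use f in auto)
  have fm: "f (u \<ominus>\<^bsub>A\<^esub> v) = f u \<ominus>\<^bsub>B\<^esub> f v" if "u \<in> carrier A" "v \<in> carrier A" for u v
  proof -
    have "f u = f (u \<ominus>\<^bsub>A\<^esub> v) \<oplus>\<^bsub>B\<^esub> f v"
      using that f(2)[of "u \<ominus>\<^bsub>A\<^esub> v" v] by (simp add: A.minus_eq A.a_assoc A.l_neg)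
    then show ?thesis using that f(1) by (simp add: B.minus_eq B.a_assoc B.r_neg)
  qed
  show ?thesis using h
  proof (induction h rule: pair_ring_induct)
    case zero then show ?case using A B by (simp add: f0)
  next
    case (diff u v)
    note k = pair_map_closed[of f A B f A B]
    have "Poly_Mapping.keys (pair_map f f u) \<subseteq> carrier B \<times> carrier B"
      "Poly_Mapping.keys (pair_map f f v) \<subseteq> carrier B \<times> carrier B"
      using k diff(1,2) f(1) by auto
    then show ?case
      using diff x f(1) A B by (simp add: pair_action_diff pair_action_closed fm)
  next
    case (of a b) then show ?case using A B x f by simp
  qed
qed

section \<open>Splitting the enveloping algebra of a product\<close>

text \<open>One factor \<open>A\<close> of a product algebra \<open>A'\<close>, described without
  naming the other factor, so that both factors become instances. The element
  \<open>i \<one>\<close> is the central idempotent of \<open>A'\<close> belonging to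
  \<open>A\<close>.\<close>

locale algebra_retract = A: assoc_algebra R A + A': assoc_algebra R A'
  for R :: "('r, 'x) ring_scheme" and A :: "('r, 'a, 'y) module_scheme"
    and A' :: "('r, 'b, 'z) module_scheme" +
  fixes p i
  assumes p: "p \<in> algebra_maps R A' A" and i: "i \<in> algebra_maps R A A'"
    and p_i: "x \<in> carrier A \<Longrightarrow> p (i x) = x"
    and i_p: "y \<in> carrier A' \<Longrightarrow> i (p y) = i \<one>\<^bsub>A\<^esub> \<otimes>\<^bsub>A'\<^esub> y"
    and central: "y \<in> carrier A' \<Longrightarrow> i \<one>\<^bsub>A\<^esub> \<otimes>\<^bsub>A'\<^esub> y = y \<otimes>\<^bsub>A'\<^esub> i \<one>\<^bsub>A\<^esub>"
begin

abbreviation "Aop \<equiv> opposite_algebra A"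
abbreviation "Aop' \<equiv> opposite_algebra A'"

sublocale P: tensor_functor R A' Aop' A Aop p p
  by (intro tensor_functor.intro tensor_functor_axioms.intro tensor_product.intro
      assoc_algebra_opposite A.assoc_algebra_axioms A'.assoc_algebra_axioms p algebra_maps_opposite)

sublocale I: tensor_functor R A Aop A' Aop' i i
  by (intro tensor_functor.intro tensor_functor_axioms.intro tensor_product.intro
      assoc_algebra_opposite A.assoc_algebra_axioms A'.assoc_algebra_axioms i algebra_maps_opposite)

abbreviation "env_proj \<equiv> tensor_map R A Aop p p"
abbreviation "env_incl \<equiv> tensor_map R A' Aop' i i"

text \<open>\<open>algebra_maps\<close> says nothing about units. Here
  \<open>i (p \<one>) = i \<one>\<close> by \<open>i_p\<close>, and applying \<open>p\<close>
  cancels \<open>i\<close>.\<close>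

lemma p_one: "p \<one>\<^bsub>A'\<^esub> = \<one>\<^bsub>A\<^esub>"
  using i_p[of "\<one>\<^bsub>A'\<^esub>"] p_i[of "\<one>\<^bsub>A\<^esub>"] p_i[of "p \<one>\<^bsub>A'\<^esub>"]
    algebra_mapsD(1)[OF p] algebra_mapsD(1)[OF i] by simp

lemma pair_map_proj_incl:
  "Poly_Mapping.keys h \<subseteq> carrier A \<times> carrier A \<Longrightarrow> pair_map p p (pair_map i i h) = h"
  by (induction h rule: pair_ring_induct) (auto simp: p_i)

text \<open>Multiplication in the second factor is reversed, so \<open>i_p\<close> alone puts the
  idempotent on the wrong side in one of the two components; \<open>central\<close> repairs this.
  The two forms together yield centrality of the idempotent of the enveloping algebra.\<close>

lemma pair_map_incl_proj:
  assumes "Poly_Mapping.keys h \<subseteq> carrier A' \<times> carrier A'"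
  shows "pair_map i i (pair_map p p h) = frag_of (i \<one>\<^bsub>A\<^esub>, i \<one>\<^bsub>A\<^esub>) \<otimes>\<^bsub>pair_ring A' Aop'\<^esub> h"
    and "pair_map i i (pair_map p p h) = h \<otimes>\<^bsub>pair_ring A' Aop'\<^esub> frag_of (i \<one>\<^bsub>A\<^esub>, i \<one>\<^bsub>A\<^esub>)"
  using assms
  by (induction h rule: pair_ring_induct)
    (auto simp: i_p central pair_mult_diff opposite_algebra_simps)

lemma incl_one: "env_incl \<one>\<^bsub>enveloping_algebra R A\<^esub> = P.T.coset (frag_of (i \<one>\<^bsub>A\<^esub>, i \<one>\<^bsub>A\<^esub>))"
  by (simp add: enveloping_algebra_def P.T'.coset_simps I.tensor_map_coset opposite_algebra_simps)

sublocale env: idempotent_corner "enveloping_algebra R A'" "enveloping_algebra R A" env_proj env_incl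
proof (intro idempotent_corner.intro idempotent_corner_axioms.intro ring_enveloping_algebra
    A.assoc_algebra_axioms A'.assoc_algebra_axioms)
  have "env_proj \<one>\<^bsub>enveloping_algebra R A'\<^esub> = \<one>\<^bsub>enveloping_algebra R A\<^esub>"
    by (simp add: enveloping_algebra_def P.T.coset_simps P.T'.coset_simps P.tensor_map_coset
        opposite_algebra_simps p_one)
  then show "env_proj \<in> ring_hom (enveloping_algebra R A') (enveloping_algebra R A)"
    by (intro ring_hom_memI) (simp_all add: enveloping_algebra_def P.tensor_map_simps)
  fix s t assume "s \<in> carrier (enveloping_algebra R A)"
  then have s: "s \<in> carrier (tensor_ring R A Aop)" by (simp add: enveloping_algebra_def)
  then show "env_incl s \<in> carrier (enveloping_algebra R A')"
    by (simp add: enveloping_algebra_def I.tensor_map_simps)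
  obtain h where h: "h \<in> carrier (pair_ring A Aop)" "s = P.T'.coset h"
    by (rule P.T'.cosetE[OF s]) auto
  then show "env_proj (env_incl s) = s"
    using pair_map_proj_incl[of h]
    by (simp only: I.tensor_map_coset P.tensor_map_coset I.pair_map_carrier) (simp add: opposite_algebra_simps)
  assume "t \<in> carrier (enveloping_algebra R A)"
  then have t: "t \<in> carrier (tensor_ring R A Aop)" by (simp add: enveloping_algebra_def)
  show "env_incl (s \<oplus>\<^bsub>enveloping_algebra R A\<^esub> t) =
      env_incl s \<oplus>\<^bsub>enveloping_algebra R A'\<^esub> env_incl t"
    "env_incl (s \<otimes>\<^bsub>enveloping_algebra R A\<^esub> t) =
      env_incl s \<otimes>\<^bsub>enveloping_algebra R A'\<^esub> env_incl t"
    using I.tensor_map_simps(2,3)[OF s t] by (simp_all add: enveloping_algebra_def)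
next
  have e: "frag_of (i \<one>\<^bsub>A\<^esub>, i \<one>\<^bsub>A\<^esub>) \<in> carrier (pair_ring A' Aop')"
    using algebra_mapsD(1)[OF i] by (simp add: opposite_algebra_simps)
  fix r assume "r \<in> carrier (enveloping_algebra R A')"
  then have r: "r \<in> carrier (tensor_ring R A' Aop')" by (simp add: enveloping_algebra_def)
  obtain h where h: "h \<in> carrier (pair_ring A' Aop')" "r = P.T.coset h"
    by (rule P.T.cosetE[OF r]) auto
  have k: "Poly_Mapping.keys h \<subseteq> carrier A' \<times> carrier A'"
    using h(1) by (simp add: opposite_algebra_simps)
  have ip: "env_incl (env_proj (P.T.coset h)) = P.T.coset (pair_map i i (pair_map p p h))"
    by (simp only: I.tensor_map_coset P.tensor_map_coset P.pair_map_carrier h(1))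
  have l: "env_incl (env_proj r) = env_incl \<one>\<^bsub>enveloping_algebra R A\<^esub> \<otimes>\<^bsub>enveloping_algebra R A'\<^esub> r"
    unfolding ip pair_map_incl_proj(1)[OF k] incl_one h(2) enveloping_algebra_def[of R A']
    by (rule P.T.coset_simps(3)[OF e h(1), symmetric])
  then show "env_incl (env_proj r) = env_incl \<one>\<^bsub>enveloping_algebra R A\<^esub> \<otimes>\<^bsub>enveloping_algebra R A'\<^esub> r" .
  \<comment> \<open>The same element, now with the idempotent on the right; comparison with
    \<open>l\<close> gives centrality.\<close>
  have "env_incl (env_proj r) = r \<otimes>\<^bsub>enveloping_algebra R A'\<^esub> env_incl \<one>\<^bsub>enveloping_algebra R A\<^esub>"
    unfolding ip pair_map_incl_proj(2)[OF k] incl_one h(2) enveloping_algebra_def[of R A']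
    by (rule P.T.coset_simps(3)[OF h(1) e, symmetric])
  then show "env_incl \<one>\<^bsub>enveloping_algebra R A\<^esub> \<otimes>\<^bsub>enveloping_algebra R A'\<^esub> r =
      r \<otimes>\<^bsub>enveloping_algebra R A'\<^esub> env_incl \<one>\<^bsub>enveloping_algebra R A\<^esub>"
    using l by simp
qed

text \<open>Semilinearity of \<open>p\<close> over the projection of enveloping algebras. It is used
  in both directions: to cut a resolution of \<open>A'\<close> down to \<open>A\<close>, and to
  recognise the restricted bimodules inside that of the product.\<close>

lemma proj_smult:
  assumes t: "t \<in> carrier (enveloping_algebra R A')" and x: "x \<in> carrier A'"
  shows "p (t \<odot>\<^bsub>regular_bimodule A'\<^esub> x) = env_proj t \<odot>\<^bsub>regular_bimodule A\<^esub> p x"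
proof -
  have t: "t \<in> carrier (tensor_ring R A' Aop')" using t by (simp add: enveloping_algebra_def)
  obtain h where h: "h \<in> carrier (pair_ring A' Aop')" "t = P.T.coset h"
    by (rule P.T.cosetE[OF t]) auto
  have k: "Poly_Mapping.keys h \<subseteq> carrier A' \<times> carrier A'"
    "Poly_Mapping.keys (pair_map p p h) \<subseteq> carrier A \<times> carrier A"
    using h(1) P.pair_map_carrier[OF h(1)] by (simp_all add: opposite_algebra_simps)
  have "p (t \<odot>\<^bsub>regular_bimodule A'\<^esub> x) = p (pair_action A' h x)"
    using smult_regular_bimodule_coset[OF A'.assoc_algebra_axioms k(1) x] by (simp add: h(2) P.T.coset_def)
  also have "\<dots> = pair_action A (pair_map p p h) (p x)"
    by (rule pair_action_map[OF A'.ring_axioms A.ring_axioms _ _ _ k(1) x]) (use algebra_mapsD[OF p] in auto)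
  also have "\<dots> = P.T'.coset (pair_map p p h) \<odot>\<^bsub>regular_bimodule A\<^esub> p x"
    using smult_regular_bimodule_coset[OF A.assoc_algebra_axioms k(2) algebra_mapsD(1)[OF p x]]
    by (simp add: P.T'.coset_def)
  also have "P.T'.coset (pair_map p p h) = env_proj t"
    unfolding h(2) by (rule P.tensor_map_coset[OF h(1), symmetric])
  finally show ?thesis .
qed

text \<open>The idempotent acts as two-sided multiplication by \<open>i \<one>\<close>, and already
  the left one gives \<open>i (p x) = i \<zero> = \<zero>\<close>.\<close>

lemma idem_smult_kernel:
  assumes x: "x \<in> carrier A'" "p x = \<zero>\<^bsub>A\<^esub>"
  shows "env_incl \<one>\<^bsub>enveloping_algebra R A\<^esub> \<odot>\<^bsub>regular_bimodule A'\<^esub> x = \<zero>\<^bsub>A'\<^esub>"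
proof -
  have i1: "i \<one>\<^bsub>A\<^esub> \<in> carrier A'" using algebra_mapsD(1)[OF i] by simp
  have "i \<zero>\<^bsub>A\<^esub> = \<zero>\<^bsub>A'\<^esub>"
    by (rule additive_hom_zero[OF A.abelian_group_axioms A'.abelian_group_axioms])
      (use algebra_mapsD[OF i] in auto)
  then have "i \<one>\<^bsub>A\<^esub> \<otimes>\<^bsub>A'\<^esub> x = \<zero>\<^bsub>A'\<^esub>" using i_p[OF x(1)] x(2) by simp
  then show ?thesis
    using smult_regular_bimodule_coset[OF A'.assoc_algebra_axioms _ x(1), of "frag_of (i \<one>\<^bsub>A\<^esub>, i \<one>\<^bsub>A\<^esub>)"]
      i1 x(1) A'.ring_axioms
    by (simp add: incl_one P.T.coset_def)
qed

lemma homologically_smooth_retract: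
  assumes "homologically_smooth R A'"
  shows "homologically_smooth R A"
  unfolding homologically_smooth_def
proof (rule env.perfect_module_corner[where M = "regular_bimodule A'" and \<tau> = p])
  show "p ` carrier (regular_bimodule A') = carrier (regular_bimodule A)"
    using algebra_mapsD(1)[OF p] algebra_mapsD(1)[OF i] p_i
    by (force simp: regular_bimodule_simps image_iff intro: p_i[symmetric])
qed (use assms algebra_mapsD[OF p] in \<open>auto simp: homologically_smooth_def proj_smult idem_smult_kernel
    regular_bimodule_simps left_module_regular_bimodule A.assoc_algebra_axioms A'.assoc_algebra_axioms\<close>)

end

section \<open>The two factors of a product algebra\<close>

lemma direct_sum_algebra_simps:
  "carrier (direct_sum_algebra A B) = carrier A \<times> carrier B"
  "(a, b) \<oplus>\<^bsub>direct_sum_algebra A B\<^esub> (a', b') = (a \<oplus>\<^bsub>A\<^esub> a', b \<oplus>\<^bsub>B\<^esub> b')"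
  "(a, b) \<otimes>\<^bsub>direct_sum_algebra A B\<^esub> (a', b') = (a \<otimes>\<^bsub>A\<^esub> a', b \<otimes>\<^bsub>B\<^esub> b')"
  "\<zero>\<^bsub>direct_sum_algebra A B\<^esub> = (\<zero>\<^bsub>A\<^esub>, \<zero>\<^bsub>B\<^esub>)"
  "r \<odot>\<^bsub>direct_sum_algebra A B\<^esub> (a, b) = (r \<odot>\<^bsub>A\<^esub> a, r \<odot>\<^bsub>B\<^esub> b)"
  by (simp_all add: direct_sum_algebra_def ring.defs module.defs RDirProd_def DirProd_def monoid.defs)

theorem proposition3p11:
  fixes k :: "('k, 'x) ring_scheme"
    and A :: "('k, 'a, 'y) module_scheme"
    and B :: "('k, 'b, 'z) module_scheme"
  assumes "field k"
    and "assoc_algebra k A"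
    and "assoc_algebra k B"
  shows "homologically_smooth k (direct_sum_algebra A B) \<longleftrightarrow>
    homologically_smooth k A \<and> homologically_smooth k B"
proof -
  let ?D = "direct_sum_algebra A B"
  interpret A: assoc_algebra k A by fact
  interpret B: assoc_algebra k B by fact
  have D: "assoc_algebra k ?D" by (rule assoc_algebra_direct_sum) fact+
  have smult_zero: "r \<odot>\<^bsub>A\<^esub> \<zero>\<^bsub>A\<^esub> = \<zero>\<^bsub>A\<^esub>" "r \<odot>\<^bsub>B\<^esub> \<zero>\<^bsub>B\<^esub> = \<zero>\<^bsub>B\<^esub>" if "r \<in> carrier k" for r
    using that by simp_all
  interpret RA: algebra_retract k A ?D fst "\<lambda>a. (a, \<zero>\<^bsub>B\<^esub>)"
    by (intro algebra_retract.intro algebra_retract_axioms.intro D assms)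
      (auto simp: algebra_maps_def left_module_hom_def direct_sum_algebra_simps smult_zero)
  interpret RB: algebra_retract k B ?D snd "\<lambda>b. (\<zero>\<^bsub>A\<^esub>, b)"
    by (intro algebra_retract.intro algebra_retract_axioms.intro D assms)
      (auto simp: algebra_maps_def left_module_hom_def direct_sum_algebra_simps smult_zero)
  show ?thesis
  proof (intro iffI conjI RA.homologically_smooth_retract RB.homologically_smooth_retract)
    assume "homologically_smooth k A \<and> homologically_smooth k B"
    then have perf: "perfect_module (enveloping_algebra k A) (regular_bimodule A)"
      "perfect_module (enveloping_algebra k B) (regular_bimodule B)"
      by (simp_all add: homologically_smooth_def)
    let ?PA = "RA.env.pullback_module (regular_bimodule A)"
    let ?PB = "RB.env.pullback_module (regular_bimodule B)"
    have lm: "left_module (enveloping_algebra k ?D) (direct_sum_module ?PA ?PB)"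
      by (intro left_module_direct_sum RA.env.left_module_pullback RB.env.left_module_pullback
          left_module_regular_bimodule assms)
    interpret reg: left_module "enveloping_algebra k ?D" "regular_bimodule ?D"
      by (rule left_module_regular_bimodule[OF D])
    \<comment> \<open>By \<open>proj_smult\<close> each component of the product depends only on the
      corresponding projections of \<open>t\<close> and \<open>x\<close>, so the action is
      componentwise.\<close>
    have smult: "t \<odot>\<^bsub>regular_bimodule ?D\<^esub> x = t \<odot>\<^bsub>direct_sum_module ?PA ?PB\<^esub> x"
      if t: "t \<in> carrier (enveloping_algebra k ?D)" and x: "x \<in> carrier ?D" for t x
    proof -
      obtain a b where "x = (a, b)" by (cases x)
      then show ?thesis using RA.proj_smult[OF t x] RB.proj_smult[OF t x]
        by (intro prod_eqI) simp_all
    qed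
    have "perfect_module (enveloping_algebra k ?D) (direct_sum_module ?PA ?PB)"
      by (intro perfect_module_direct_sum RA.env.perfect_module_pullback
          RB.env.perfect_module_pullback perf)
    \<comment> \<open>The two modules have the same carrier and the same operations on it, so the
      isomorphism is the identity.\<close>
    moreover have "(\<lambda>x. x) \<in> left_module_hom (enveloping_algebra k ?D)
        (direct_sum_module ?PA ?PB) (regular_bimodule ?D)"
      by (rule left_module_homI)
        (auto simp: regular_bimodule_simps direct_sum_algebra_simps smult)
    moreover have "bij_betw (\<lambda>x. x) (carrier (direct_sum_module ?PA ?PB)) (carrier (regular_bimodule ?D))"
      by (simp add: bij_betw_def regular_bimodule_simps direct_sum_algebra_simps)
    ultimately show "homologically_smooth k ?D"
      unfolding homologically_smooth_def
      using perfect_module_iso[OF lm reg.left_module_axioms] by blast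
  qed
qed

end
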